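(* Let $(\Omega,S)$ be a commutative pseudocyclic scheme of valency $k$ and let $G$ be a group of algebraic isomorphisms of $(\Omega,S)$ to itself acting semiregularly on $S^\#$ (i.e. no non-identity element of $G$ fixes an element of $S^\#$). Then $(\Omega,S^G)$ is a commutative pseudocyclic scheme of valency $k|G|$.
   Context: A coherent configuration is a pair $(\Omega,S)$ where $\Omega$ is a finite set and $S$ is a partition of $\Omega\times\Omega$ such that the diagonal $1_\Omega$ is a union of elements of $S$, $S$ is closed under transposition, and for $r,s,t\in S$ the number $c_{rs}^t=|\{\beta:(\alpha,\beta)\in r,(\beta,\gamma)\in s\}|$ does not depend on $(\alpha,\gamma)\in t$. A scheme is a coherent configuration with $1_\Omega\in S$; $S^\#=S\setminus\{1_\Omega\}$; valency $n_s=|\{\beta:(\alpha,\beta)\in s\}|$. The adjacency algebra $\mathbb{C}S$ is spanned by adjacency matrices; with $\mathcal P$ its set of central primitive idempotents, $n_P$ the dimension of an irreducible submodule of $\mathbb{C}^\Omega$ corresponding to $P$, $m_P=\operatorname{rk}(P)/n_P$, $P_0=\frac1{|\Omega|}J$, $\mathcal P^\#=\mathcal P\setminus\{P_0\}$: the scheme is pseudocyclic if $m_P/n_P$ is constant on $\mathcal P^\#$, and commutative if $\mathbb{C}S$ is commutative. A pseudocyclic scheme has $n_s=k$ for all $s\in S^\#$ for some $k$ (its valency), and conversely "pseudocyclic of valency $k$" means pseudocyclic with all $n_s=k$, $s\in S^\#$. An algebraic isomorphism of $(\Omega,S)$ to itself is a bijection $g:S\to S$ with $c_{g(r)g(s)}^{g(t)}=c_{rs}^t$.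 For such a group $G$ and $s\in S$ let $s^G=\bigcup_{g\in G}g(s)$ and $S^G=\{s^G:s\in S\}$. *)

theory Defs
  imports Complex_Main
begin

type_synonym 'a rel = "('a \<times> 'a) set"

definition partition_of :: "'b set \<Rightarrow> 'b set set \<Rightarrow> bool" where
  "partition_of X P \<longleftrightarrow> (\<forall>s\<in>P. s \<noteq> {}) \<and> \<Union>P = X \<and>
     (\<forall>r\<in>P. \<forall>s\<in>P. r \<noteq> s \<longrightarrow> r \<inter> s = {})"

definition coherent_configuration :: "'a set \<Rightarrow> 'a rel set \<Rightarrow> bool" where
  "coherent_configuration \<Omega> S \<longleftrightarrow>
     finite \<Omega> \<and> partition_of (\<Omega> \<times> \<Omega>) S \<and>
     (\<exists>T\<subseteq>S. \<Union>T = Id_on \<Omega>) \<and>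
     (\<forall>s\<in>S. converse s \<in> S) \<and>
     (\<forall>r\<in>S. \<forall>s\<in>S. \<forall>t\<in>S. \<forall>\<alpha> \<gamma> \<alpha>' \<gamma>'. (\<alpha>,\<gamma>) \<in> t \<longrightarrow> (\<alpha>',\<gamma>') \<in> t \<longrightarrow>
        card {\<beta>. (\<alpha>,\<beta>) \<in> r \<and> (\<beta>,\<gamma>) \<in> s} = card {\<beta>. (\<alpha>',\<beta>) \<in> r \<and> (\<beta>,\<gamma>') \<in> s})"

definition scheme :: "'a set \<Rightarrow> 'a rel set \<Rightarrow> bool" where
  "scheme \<Omega> S \<longleftrightarrow> coherent_configuration \<Omega> S \<and> Id_on \<Omega> \<in> S"

text \<open>Intersection number c_{rs}^t, computed at some (any) pair of t.\<close>
definition inter_num :: "'a rel \<Rightarrow> 'a rel \<Rightarrow> 'a rel \<Rightarrow> nat" where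
  "inter_num r s t = (case (SOME p. p \<in> t) of (\<alpha>,\<gamma>) \<Rightarrow> card {\<beta>. (\<alpha>,\<beta>) \<in> r \<and> (\<beta>,\<gamma>) \<in> s})"

definition has_valency :: "'a set \<Rightarrow> 'a rel \<Rightarrow> nat \<Rightarrow> bool" where
  "has_valency \<Omega> s k \<longleftrightarrow> (\<forall>\<alpha>\<in>\<Omega>. card {\<beta>. (\<alpha>,\<beta>) \<in> s} = k)"

type_synonym 'a cmat = "'a \<Rightarrow> 'a \<Rightarrow> complex"
type_synonym 'a cvec = "'a \<Rightarrow> complex"

definition adj :: "'a rel \<Rightarrow> 'a cmat" where
  "adj s = (\<lambda>x y. if (x,y) \<in> s then 1 else 0)"

definition mmult :: "'a set \<Rightarrow> 'a cmat \<Rightarrow> 'a cmat \<Rightarrow> 'a cmat" where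
  "mmult \<Omega> A B = (\<lambda>x z. \<Sum>y\<in>\<Omega>. A x y * B y z)"

definition mvmult :: "'a set \<Rightarrow> 'a cmat \<Rightarrow> 'a cvec \<Rightarrow> 'a cvec" where
  "mvmult \<Omega> A v = (\<lambda>x. \<Sum>y\<in>\<Omega>. A x y * v y)"

definition adj_algebra :: "'a rel set \<Rightarrow> 'a cmat set" where
  "adj_algebra S = {(\<lambda>x y. \<Sum>s\<in>S. c s * adj s x y) | c. True}"

definition commutative_cc :: "'a set \<Rightarrow> 'a rel set \<Rightarrow> bool" where
  "commutative_cc \<Omega> S \<longleftrightarrow>
     (\<forall>A\<in>adj_algebra S. \<forall>B\<in>adj_algebra S. mmult \<Omega> A B = mmult \<Omega> B A)"

definition cvecs :: "'a set \<Rightarrow> 'a cvec set" where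
  "cvecs \<Omega> = {v. \<forall>x. x \<notin> \<Omega> \<longrightarrow> v x = 0}"

definition lin_indep :: "'a set \<Rightarrow> 'a cvec set \<Rightarrow> bool" where
  "lin_indep \<Omega> V \<longleftrightarrow> finite V \<and>
     (\<forall>c. (\<forall>x\<in>\<Omega>. (\<Sum>v\<in>V. c v * v x) = 0) \<longrightarrow> (\<forall>v\<in>V. c v = 0))"

definition sdim :: "'a set \<Rightarrow> 'a cvec set \<Rightarrow> nat" where
  "sdim \<Omega> W = Max {card V | V. V \<subseteq> W \<and> lin_indep \<Omega> V}"

definition mrank :: "'a set \<Rightarrow> 'a cmat \<Rightarrow> nat" where
  "mrank \<Omega> A = Max {card V | V. V \<subseteq> {(\<lambda>x. if x \<in> \<Omega> then A x y else 0) | y. y \<in> \<Omega>}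
                                   \<and> lin_indep \<Omega> V}"

definition central_idempotent :: "'a set \<Rightarrow> 'a rel set \<Rightarrow> 'a cmat \<Rightarrow> bool" where
  "central_idempotent \<Omega> S P \<longleftrightarrow> P \<in> adj_algebra S \<and> mmult \<Omega> P P = P \<and>
     (\<forall>A\<in>adj_algebra S. mmult \<Omega> P A = mmult \<Omega> A P)"

definition central_primitive_idempotents :: "'a set \<Rightarrow> 'a rel set \<Rightarrow> 'a cmat set" where
  "central_primitive_idempotents \<Omega> S =
     {P. central_idempotent \<Omega> S P \<and> P \<noteq> (\<lambda>x y. 0) \<and>
         \<not> (\<exists>P1 P2. central_idempotent \<Omega> S P1 \<and> central_idempotent \<Omega> S P2 \<and>
                 P1 \<noteq> (\<lambda>x y. 0) \<and> P2 \<noteq> (\<lambda>x y. 0) \<and>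
                 mmult \<Omega> P1 P2 = (\<lambda>x y. 0) \<and> P = (\<lambda>x y. P1 x y + P2 x y))}"

definition submodule :: "'a set \<Rightarrow> 'a rel set \<Rightarrow> 'a cvec set \<Rightarrow> bool" where
  "submodule \<Omega> S W \<longleftrightarrow> W \<subseteq> cvecs \<Omega> \<and> (\<lambda>x. 0) \<in> W \<and>
     (\<forall>v\<in>W. \<forall>w\<in>W. (\<lambda>x. v x + w x) \<in> W) \<and>
     (\<forall>v\<in>W. \<forall>c. (\<lambda>x. c * v x) \<in> W) \<and>
     (\<forall>A\<in>adj_algebra S. \<forall>v\<in>W. mvmult \<Omega> A v \<in> W)"

definition irreducible_submodule :: "'a set \<Rightarrow> 'a rel set \<Rightarrow> 'a cvec set \<Rightarrow> bool" where
  "irreducible_submodule \<Omega> S W \<longleftrightarrow> submodule \<Omega> S W \<and> W \<noteq> {\<lambda>x. 0} \<and>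
     (\<forall>U. submodule \<Omega> S U \<and> U \<subseteq> W \<longrightarrow> U = {\<lambda>x. 0} \<or> U = W)"

text \<open>An irreducible submodule corresponds to the central primitive idempotent P
  if P acts as the identity on it.\<close>
definition irreducible_for :: "'a set \<Rightarrow> 'a rel set \<Rightarrow> 'a cmat \<Rightarrow> 'a cvec set \<Rightarrow> bool" where
  "irreducible_for \<Omega> S P W \<longleftrightarrow> irreducible_submodule \<Omega> S W \<and> (\<forall>v\<in>W. mvmult \<Omega> P v = v)"

definition n_P :: "'a set \<Rightarrow> 'a rel set \<Rightarrow> 'a cmat \<Rightarrow> nat" where
  "n_P \<Omega> S P = (SOME d. \<exists>W. irreducible_for \<Omega> S P W \<and> sdim \<Omega> W = d)"

definition m_P :: "'a set \<Rightarrow> 'a rel set \<Rightarrow> 'a cmat \<Rightarrow> real" where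
  "m_P \<Omega> S P = real (mrank \<Omega> P) / real (n_P \<Omega> S P)"

definition P0 :: "'a set \<Rightarrow> 'a cmat" where
  "P0 \<Omega> = (\<lambda>x y. if x \<in> \<Omega> \<and> y \<in> \<Omega> then 1 / of_nat (card \<Omega>) else 0)"

definition pseudocyclic :: "'a set \<Rightarrow> 'a rel set \<Rightarrow> bool" where
  "pseudocyclic \<Omega> S \<longleftrightarrow> scheme \<Omega> S \<and>
     (\<exists>q. \<forall>P \<in> central_primitive_idempotents \<Omega> S - {P0 \<Omega>}.
            m_P \<Omega> S P / real (n_P \<Omega> S P) = q)"

definition pseudocyclic_of_valency :: "'a set \<Rightarrow> 'a rel set \<Rightarrow> nat \<Rightarrow> bool" where
  "pseudocyclic_of_valency \<Omega> S k \<longleftrightarrow> pseudocyclic \<Omega> S \<and>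
     (\<forall>s \<in> S - {Id_on \<Omega>}. has_valency \<Omega> s k)"

definition algebraic_automorphism :: "'a rel set \<Rightarrow> ('a rel \<Rightarrow> 'a rel) \<Rightarrow> bool" where
  "algebraic_automorphism S g \<longleftrightarrow> bij_betw g S S \<and>
     (\<forall>r\<in>S. \<forall>s\<in>S. \<forall>t\<in>S. inter_num (g r) (g s) (g t) = inter_num r s t)"

text \<open>A group of algebraic isomorphisms; elements are taken extensional
  (identity outside S), so that distinct elements are distinct maps on S.\<close>
definition alg_iso_group :: "'a rel set \<Rightarrow> ('a rel \<Rightarrow> 'a rel) set \<Rightarrow> bool" where
  "alg_iso_group S G \<longleftrightarrow>
     (\<forall>g\<in>G. algebraic_automorphism S g \<and> (\<forall>r. r \<notin> S \<longrightarrow> g r = r)) \<and>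
     id \<in> G \<and> (\<forall>g\<in>G. \<forall>h\<in>G. g \<circ> h \<in> G) \<and> (\<forall>g\<in>G. \<exists>h\<in>G. h \<circ> g = id)"

definition semiregular_on :: "('a rel \<Rightarrow> 'a rel) set \<Rightarrow> 'a rel set \<Rightarrow> bool" where
  "semiregular_on G T \<longleftrightarrow> (\<forall>g\<in>G. \<forall>s\<in>T. g s = s \<longrightarrow> g = id)"

definition orbit_rel :: "('a rel \<Rightarrow> 'a rel) set \<Rightarrow> 'a rel \<Rightarrow> 'a rel" where
  "orbit_rel G s = (\<Union>g\<in>G. g s)"

definition merged :: "('a rel \<Rightarrow> 'a rel) set \<Rightarrow> 'a rel set \<Rightarrow> 'a rel set" where
  "merged G S = orbit_rel G ` S"

end

theory Submission
  imports Defs "HOL-Library.Function_Algebras"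
    "HOL-Computational_Algebra.Fundamental_Theorem_Algebra"
begin

text \<open>In a commutative scheme every irreducible submodule is a line, so \<open>n\<^sub>P = 1\<close> and \<open>m\<^sub>P\<close> is the
  rank, equivalently the trace, of the primitive idempotent \<open>P\<close>; pseudocyclicity says that all
  \<open>P \<noteq> P\<^sub>0\<close> have the same rank \<open>q\<close>. The group \<open>G\<close> acts on the adjacency algebra by permuting the
  adjacency matrices, and this action is multiplicative and preserves the trace; the
  adjacency algebra of the merged scheme is the subalgebra of fixed points. As in Brauer's
  permutation lemma, an element \<open>g\<close> fixes as many primitive idempotents as basis relations, so
  semiregularity on \<open>S\<^sup>#\<close> passes to the primitive idempotents other than \<open>P\<^sub>0\<close>. Hence the
  primitive idempotents of the merged scheme other than \<open>P\<^sub>0\<close> are the sums over regular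
  \<open>G\<close>-orbits, and they all have rank \<open>|G| q\<close>.\<close>

section \<open>Complex matrices indexed by a finite set\<close>

text \<open>Brauer's lemma is a statement about one trace: the linear map \<open>act S g\<close> on
  the algebra permutes both the adjacency matrices and the primitive idempotents, so its trace
  counts the fixed members of either basis. For the form \<open>tr (X Y)\<close> the basis dual to
  the \<open>A_s\<close> is \<open>A_{s*} / (n n_s)\<close>, with \<open>n\<close> the number of
  points; hence this trace is \<open>tr M / n\<close>, where \<open>M\<close> is the sum of all
  \<open>A_{s*} A_{g s} / n_s\<close>. Multiplying \<open>M\<close> by a primitive \<open>R\<close>
  isolates the contribution of \<open>R\<close>. Only an inequality is needed: \<open>P0\<close>
  already accounts for the single fixed relation and every idempotent contributes a nonnegative
  amount, so no second fixed primitive fits. Thus no complete list of primitive idempotents is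
  formed; induction on the rank of an idempotent replaces it. The algebra has no nonzero nilpotents
  because it is closed under conjugate transposition. Ranks are always compared through traces,
  since the trace is additive and visibly invariant under \<open>G\<close>.\<close>

definition smul :: "complex \<Rightarrow> 'a cmat \<Rightarrow> 'a cmat" (infixr "\<odot>" 75) where
  "c \<odot> A = (\<lambda>x y. c * A x y)"

definition mtrace :: "'a set \<Rightarrow> 'a cmat \<Rightarrow> complex" where
  "mtrace \<Omega> A = (\<Sum>x\<in>\<Omega>. A x x)"

definition dagger :: "'a cmat \<Rightarrow> 'a cmat" where
  "dagger A = (\<lambda>x y. cnj (A y x))"

lemma smul_apply [simp]: "(c \<odot> A) x y = c * A x y"
  by (simp add: smul_def)

lemma sum_mat_apply:
  fixes f :: "'i \<Rightarrow> 'a cmat"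
  shows "(\<Sum>i\<in>I. f i) x y = (\<Sum>i\<in>I. f i x y)"
  by (induction I rule: infinite_finite_induct) auto

lemma smul_add_right: "c \<odot> (A + B) = c \<odot> A + c \<odot> B"
  and smul_add_left: "(c + d) \<odot> A = c \<odot> A + d \<odot> A"
  and smul_diff_left: "(c - d) \<odot> A = c \<odot> A - d \<odot> A"
  and smul_smul [simp]: "c \<odot> d \<odot> A = (c * d) \<odot> A"
  and smul_one [simp]: "1 \<odot> A = A"
  and smul_zero_left [simp]: "0 \<odot> A = 0"
  and smul_zero_right [simp]: "c \<odot> (0 :: 'a cmat) = 0"
  by (auto simp: fun_eq_iff algebra_simps)

lemma smul_sum: "c \<odot> (\<Sum>i\<in>I. f i) = (\<Sum>i\<in>I. c \<odot> f i)"
  by (auto simp: fun_eq_iff sum_mat_apply sum_distrib_left)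

lemma smul_eq_0_iff [simp]: "c \<odot> A = 0 \<longleftrightarrow> c = 0 \<or> A = 0"
  by (auto simp: fun_eq_iff)

lemma mmult_assoc: "mmult \<Omega> (mmult \<Omega> A B) C = mmult \<Omega> A (mmult \<Omega> B C)"
proof (intro ext)
  fix x z
  have "mmult \<Omega> (mmult \<Omega> A B) C x z = (\<Sum>y\<in>\<Omega>. \<Sum>w\<in>\<Omega>. A x w * B w y * C y z)"
    by (simp add: mmult_def sum_distrib_right)
  also have "\<dots> = (\<Sum>w\<in>\<Omega>. \<Sum>y\<in>\<Omega>. A x w * B w y * C y z)"
    by (rule sum.swap)
  finally show "mmult \<Omega> (mmult \<Omega> A B) C x z = mmult \<Omega> A (mmult \<Omega> B C) x z"
    by (simp add: mmult_def sum_distrib_left mult.assoc)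
qed

lemma mmult_add_left: "mmult \<Omega> (A + B) C = mmult \<Omega> A C + mmult \<Omega> B C"
  and mmult_add_right: "mmult \<Omega> C (A + B) = mmult \<Omega> C A + mmult \<Omega> C B"
  and mmult_diff_left: "mmult \<Omega> (A - B) C = mmult \<Omega> A C - mmult \<Omega> B C"
  and mmult_diff_right: "mmult \<Omega> C (A - B) = mmult \<Omega> C A - mmult \<Omega> C B"
  by (auto simp: fun_eq_iff mmult_def algebra_simps sum.distrib sum_subtractf)

lemma mmult_smul_left [simp]: "mmult \<Omega> (c \<odot> A) B = c \<odot> mmult \<Omega> A B"
  and mmult_smul_right [simp]: "mmult \<Omega> A (c \<odot> B) = c \<odot> mmult \<Omega> A B"
  by (auto simp: fun_eq_iff mmult_def sum_distrib_left mult_ac)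

lemma mmult_zero_left [simp]: "mmult \<Omega> 0 A = 0"
  and mmult_zero_right [simp]: "mmult \<Omega> A 0 = 0"
  by (auto simp: fun_eq_iff mmult_def)

lemma mmult_sum_left: "mmult \<Omega> (\<Sum>i\<in>I. f i) A = (\<Sum>i\<in>I. mmult \<Omega> (f i) A)"
  using sum_comp_morphism[of "\<lambda>X. mmult \<Omega> X A" f I] by (simp add: mmult_add_left o_def)

lemma mmult_sum_right: "mmult \<Omega> A (\<Sum>i\<in>I. f i) = (\<Sum>i\<in>I. mmult \<Omega> A (f i))"
  using sum_comp_morphism[of "mmult \<Omega> A" f I] by (simp add: mmult_add_right o_def)

lemma mtrace_add: "mtrace \<Omega> (A + B) = mtrace \<Omega> A + mtrace \<Omega> B"
  and mtrace_diff: "mtrace \<Omega> (A - B) = mtrace \<Omega> A - mtrace \<Omega> B"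
  and mtrace_smul [simp]: "mtrace \<Omega> (c \<odot> A) = c * mtrace \<Omega> A"
  and mtrace_zero [simp]: "mtrace \<Omega> 0 = 0"
  by (simp_all add: mtrace_def sum.distrib sum_subtractf sum_distrib_left)

lemma mtrace_sum: "mtrace \<Omega> (\<Sum>i\<in>I. f i) = (\<Sum>i\<in>I. mtrace \<Omega> (f i))"
  using sum_comp_morphism[of "mtrace \<Omega>" f I] by (simp add: mtrace_add o_def)

lemma dagger_mmult: "dagger (mmult \<Omega> A B) = mmult \<Omega> (dagger B) (dagger A)"
  by (auto simp: fun_eq_iff dagger_def mmult_def mult.commute)

lemma dagger_dagger [simp]: "dagger (dagger A) = A"
  by (simp add: dagger_def)

text \<open>The diagonal entries of \<open>A\<close> times its conjugate transpose are the squared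
  norms of the rows of \<open>A\<close>.\<close>

lemma mmult_dagger_self_eq_0D:
  assumes "finite \<Omega>" and "\<And>x y. x \<notin> \<Omega> \<or> y \<notin> \<Omega> \<Longrightarrow> A x y = 0"
    and "mmult \<Omega> A (dagger A) = 0"
  shows "A = 0"
proof (intro ext)
  fix x y
  have "mmult \<Omega> A (dagger A) x x = of_real (\<Sum>y\<in>\<Omega>. (cmod (A x y))\<^sup>2)"
    unfolding mmult_def dagger_def of_real_sum complex_norm_square ..
  then have "(\<Sum>y\<in>\<Omega>. (cmod (A x y))\<^sup>2) = 0"
    using assms(3) by (metis of_real_eq_0_iff zero_fun_apply)
  then have "\<forall>y\<in>\<Omega>. (cmod (A x y))\<^sup>2 = 0"
    using assms(1) by (subst (asm) sum_nonneg_eq_0_iff) auto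
  then show "A x y = (0 :: 'a cmat) x y"
    using assms(2) by (cases "y \<in> \<Omega>") auto
qed

section \<open>Linear dependence and eigenvectors, by elimination and annihilating
  polynomials\<close>

lemma homogeneous_system_nontrivial_solution:
  fixes f :: "'i \<Rightarrow> 'x \<Rightarrow> 'f :: field"
  assumes "finite X" and "finite I" and "card X < card I"
  shows "\<exists>c. (\<exists>i\<in>I. c i \<noteq> 0) \<and> (\<forall>x\<in>X. (\<Sum>i\<in>I. c i * f i x) = 0)"
  using assms
proof (induction X arbitrary: I f rule: finite_induct)
  case empty
  then have "I \<noteq> {}" by auto
  then show ?case by (intro exI[of _ "\<lambda>_. 1"]) auto
next
  case (insert x X)
  show ?case
  proof (cases "\<forall>i\<in>I. f i x = 0")
    case True
    have "card X < card I" using insert by simp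
    from insert.IH[OF insert.prems(1) this, of f] obtain c
      where "\<exists>i\<in>I. c i \<noteq> 0" "\<forall>x\<in>X. (\<Sum>i\<in>I. c i * f i x) = 0" by blast
    with True show ?thesis by (intro exI[of _ c]) auto
  next
    case False
    then obtain j where j: "j \<in> I" "f j x \<noteq> 0" by blast
    let ?I = "I - {j}"
    \<comment> \<open>Gaussian elimination: equation \<open>x\<close> is used to remove the unknown
      \<open>j\<close> from the other equations, and it leaves \<open>g i x = 0\<close>.\<close>
    define g where "g i y = f i y - f i x / f j x * f j y" for i y
    have "card X < card ?I" using insert j by simp
    from insert.IH[OF _ this, of g] insert.prems obtain c
      where c: "\<exists>i\<in>?I. c i \<noteq> 0" "\<forall>y\<in>X. (\<Sum>i\<in>?I. c i * g i y) = 0" by auto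
    \<comment> \<open>The value at \<open>j\<close> is the one that equation \<open>x\<close>
      forces.\<close>
    define d where "d i = (if i = j then - (\<Sum>i\<in>?I. c i * f i x / f j x) else c i)" for i
    have split: "(\<Sum>i\<in>I. d i * f i y) = (\<Sum>i\<in>?I. c i * g i y)" for y
    proof -
      have "(\<Sum>i\<in>I. d i * f i y) = d j * f j y + (\<Sum>i\<in>?I. d i * f i y)"
        using insert.prems j by (simp add: sum.remove)
      also have "(\<Sum>i\<in>?I. d i * f i y) = (\<Sum>i\<in>?I. c i * f i y)"
        by (intro sum.cong) (auto simp: d_def)
      also have "d j * f j y = - (\<Sum>i\<in>?I. c i * (f i x / f j x * f j y))"
        by (simp add: d_def sum_distrib_left mult_ac)
      finally show ?thesis
        by (simp add: g_def right_diff_distrib sum_subtractf)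
    qed
    have "(\<Sum>i\<in>?I. c i * g i x) = 0"
      using j by (simp add: g_def)
    moreover have "\<exists>i\<in>I. d i \<noteq> 0" using c(1) by (auto simp: d_def)
    ultimately show ?thesis using split c(2) by (intro exI[of _ d]) auto
  qed
qed

text \<open>Factoring a root \<open>\<lambda>\<close> out of an annihilating polynomial replaces \<open>v\<close> by
  \<open>L v - \<lambda> v\<close>; the last nonzero vector reached in this way is an eigenvector.\<close>

lemma eigenmatrix_of_annihilating_poly:
  assumes add: "\<And>A B. L (A + B) = L A + L B" and smul: "\<And>c A. L (c \<odot> A) = c \<odot> L A"
    and W_add: "\<And>A B. A \<in> W \<Longrightarrow> B \<in> W \<Longrightarrow> A + B \<in> W"
    and W_smul: "\<And>c A. A \<in> W \<Longrightarrow> c \<odot> A \<in> W" and W_L: "\<And>A. A \<in> W \<Longrightarrow> L A \<in> W"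
    and "v \<in> W" "v \<noteq> 0" "p \<noteq> 0" "(\<Sum>i\<le>degree p. coeff p i \<odot> (L ^^ i) v) = 0"
  shows "\<exists>u\<in>W. u \<noteq> 0 \<and> (\<exists>l. L u = l \<odot> u)"
  using assms(6-9)
proof (induction "degree p" arbitrary: p v)
  case 0
  have "coeff p 0 \<odot> v = (\<Sum>i\<le>degree p. coeff p i \<odot> (L ^^ i) v)"
    using \<open>0 = degree p\<close> by simp
  also have "\<dots> = 0" by (rule 0)
  finally have "coeff p 0 \<odot> v = 0" .
  moreover have "coeff p 0 \<noteq> 0" using 0 by (metis leading_coeff_0_iff)
  moreover have "v \<noteq> 0" by (rule 0)
  ultimately show ?case by simp
next
  case (Suc d)
  have "\<not> constant (poly p)"
    using Suc.hyps(2) by (simp add: constant_degree)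
  then obtain l where "poly p l = 0"
    using fundamental_theorem_of_algebra by blast
  then obtain q where p: "p = [:-l, 1:] * q"
    by (auto simp: poly_eq_0_iff_dvd elim: dvdE)
  with Suc.prems have "q \<noteq> 0" by auto
  then have d: "degree q = d"
    using Suc.hyps(2) unfolding p by (subst (asm) degree_mult_eq) auto
  define u where "u = L v + (- l) \<odot> v"
  have u: "u \<in> W" using Suc.prems by (auto simp: u_def intro: W_add W_smul W_L)
  show ?case
  proof (cases "u = 0")
    case True
    then have "L v = l \<odot> v" by (auto simp: u_def fun_eq_iff)
    with Suc.prems show ?thesis by blast
  next
    case False
    \<comment> \<open>From \<open>p = (x - l) q\<close> follows \<open>p(L) v = q(L) u\<close>, so
      \<open>q\<close> annihilates \<open>u\<close>; the computation below is this identity in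
      coefficients.\<close>
    have Lu: "(L ^^ i) u = (L ^^ Suc i) v + (- l) \<odot> (L ^^ i) v" for i
      by (induction i) (simp_all only: u_def add smul funpow.simps id_apply o_apply)
    have p0: "coeff p 0 = - l * coeff q 0" and pS: "coeff p (Suc i) = coeff q i - l * coeff q (Suc i)" for i
      by (simp_all add: p)
    \<comment> \<open>This zero coefficient lets the sum for \<open>q\<close> run up to
      \<open>Suc d\<close>, so that its shift aligns with the sum for \<open>p\<close>.\<close>
    have top: "coeff q (Suc d) = 0" using d by (simp add: coeff_eq_0)
    let ?Q = "\<lambda>i. coeff q i \<odot> (L ^^ i) v"
    have "(\<Sum>i\<le>d. coeff q i \<odot> (L ^^ i) u)
        = (\<Sum>i\<le>d. coeff q i \<odot> (L ^^ Suc i) v) + (- l) \<odot> (\<Sum>i\<le>d. ?Q i)"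
      by (simp add: Lu smul_add_right sum.distrib smul_sum mult.commute del: funpow.simps)
    also have "(\<Sum>i\<le>d. ?Q i) = (\<Sum>i\<le>Suc d. ?Q i)" by (simp add: top)
    also have "\<dots> = ?Q 0 + (\<Sum>i\<le>d. ?Q (Suc i))" by (rule sum.atMost_Suc_shift)
    also have "(\<Sum>i\<le>d. coeff q i \<odot> (L ^^ Suc i) v) + (- l) \<odot> (?Q 0 + (\<Sum>i\<le>d. ?Q (Suc i)))
        = coeff p 0 \<odot> (L ^^ 0) v + (\<Sum>i\<le>d. coeff p (Suc i) \<odot> (L ^^ Suc i) v)"
      by (simp add: p0 pS smul_add_right smul_diff_left sum.distrib sum_subtractf smul_sum
          fun_eq_iff sum_negf sum_mat_apply del: funpow.simps)
    also have "\<dots> = (\<Sum>i\<le>Suc d. coeff p i \<odot> (L ^^ i) v)"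
      by (rule sum.atMost_Suc_shift[symmetric])
    also have "\<dots> = 0" using Suc by simp
    finally have "(\<Sum>i\<le>degree q. coeff q i \<odot> (L ^^ i) u) = 0" unfolding d .
    from Suc.hyps(1)[OF _ u False \<open>q \<noteq> 0\<close> this] d show ?thesis by simp
  qed
qed

text \<open>The iterates of \<open>v\<close> under \<open>L\<close> have only finitely many
  coordinates, so sufficiently many of them satisfy a linear relation, which is an annihilating
  polynomial. Working inside an invariant \<open>W\<close> allows joint eigenvectors to be found one
  operator at a time.\<close>

lemma eigenmatrix_exists:
  assumes fin: "finite \<Omega>" and supp: "\<And>A x y. A \<in> W \<Longrightarrow> x \<notin> \<Omega> \<or> y \<notin> \<Omega> \<Longrightarrow> A x y = 0"
    and add: "\<And>A B. L (A + B) = L A + L B" and smul: "\<And>c A. L (c \<odot> A) = c \<odot> L A"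
    and W_add: "\<And>A B. A \<in> W \<Longrightarrow> B \<in> W \<Longrightarrow> A + B \<in> W"
    and W_smul: "\<And>c A. A \<in> W \<Longrightarrow> c \<odot> A \<in> W" and W_L: "\<And>A. A \<in> W \<Longrightarrow> L A \<in> W"
    and v: "v \<in> W" "v \<noteq> 0"
  shows "\<exists>u\<in>W. u \<noteq> 0 \<and> (\<exists>l. L u = l \<odot> u)"
proof -
  \<comment> \<open>The range \<open>{..?N}\<close> has \<open>?N + 1\<close> indices, one more than
    there are coordinates.\<close>
  let ?N = "card (\<Omega> \<times> \<Omega>)"
  obtain c where c: "\<exists>i\<in>{..?N}. c i \<noteq> 0"
    "\<forall>z\<in>\<Omega>\<times>\<Omega>. (\<Sum>i\<in>{..?N}. c i * (L ^^ i) v (fst z) (snd z)) = 0"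
    using homogeneous_system_nontrivial_solution[of "\<Omega> \<times> \<Omega>" "{..?N}"
        "\<lambda>i z. (L ^^ i) v (fst z) (snd z)"] fin by (auto simp: card_atMost)
  have LW: "(L ^^ i) v \<in> W" for i by (induction i) (auto simp: v W_L)
  have rel: "(\<Sum>i\<le>?N. c i \<odot> (L ^^ i) v) = 0"
  proof (intro ext)
    fix x y
    show "(\<Sum>i\<le>?N. c i \<odot> (L ^^ i) v) x y = (0 :: 'a cmat) x y"
      using c(2) supp[OF LW, of x y] by (cases "x \<in> \<Omega> \<and> y \<in> \<Omega>") (auto simp: sum_mat_apply)
  qed
  define p where "p = (\<Sum>i\<le>?N. monom (c i) i)"
  have cp: "coeff p i = (if i \<le> ?N then c i else 0)" for i
    by (simp add: p_def coeff_sum sum.delta)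
  have "p \<noteq> 0" using c(1) cp by (metis atMost_iff coeff_0)
  have "degree p \<le> ?N" by (intro degree_le) (auto simp: cp)
  have "(\<Sum>i\<le>degree p. coeff p i \<odot> (L ^^ i) v) = (\<Sum>i\<le>?N. coeff p i \<odot> (L ^^ i) v)"
    using \<open>degree p \<le> ?N\<close> by (intro sum.mono_neutral_left) (auto simp: coeff_eq_0)
  also have "\<dots> = 0" using rel by (simp add: cp)
  finally show ?thesis
    using eigenmatrix_of_annihilating_poly[OF add smul W_add W_smul W_L v \<open>p \<noteq> 0\<close>] by blast
qed

section \<open>Rank, trace and dimension\<close>

lemma maximal_lin_indep_spans:
  assumes V: "lin_indep \<Omega> V" and max: "u \<in> V \<or> \<not> lin_indep \<Omega> (insert u V)"
  shows "\<exists>f. \<forall>x\<in>\<Omega>. u x = (\<Sum>v\<in>V. f v * v x)"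
proof (cases "u \<in> V")
  case True
  have "finite V" using V by (simp add: lin_indep_def)
  then show ?thesis
    using True by (intro exI[of _ "\<lambda>v. if v = u then 1 else 0"])
      (simp add: if_distrib[of "\<lambda>a. a * _"] sum.delta cong: if_cong)
next
  case False
  have fin: "finite V" using V by (simp add: lin_indep_def)
  from False max obtain c where c: "\<forall>x\<in>\<Omega>. (\<Sum>v\<in>insert u V. c v * v x) = 0"
    and nz: "\<exists>v\<in>insert u V. c v \<noteq> 0"
    using fin unfolding lin_indep_def by auto
  have eq: "c u * u x + (\<Sum>v\<in>V. c v * v x) = 0" if "x \<in> \<Omega>" for x
    using c that False fin by simp
  \<comment> \<open>Otherwise the relation would already be one within the independent set
    \<open>V\<close>. Hence it can be solved for \<open>u\<close>.\<close>
  have "c u \<noteq> 0"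
  proof
    assume "c u = 0"
    with eq have "\<forall>x\<in>\<Omega>. (\<Sum>v\<in>V. c v * v x) = 0" by simp
    with V have "\<forall>v\<in>V. c v = 0" unfolding lin_indep_def by blast
    with nz \<open>c u = 0\<close> show False by auto
  qed
  have "u x = (\<Sum>v\<in>V. (- c v / c u) * v x)" if "x \<in> \<Omega>" for x
  proof -
    have "(\<Sum>v\<in>V. (- c v / c u) * v x) = - (\<Sum>v\<in>V. c v * v x) / c u"
      by (simp add: sum_negf sum_divide_distrib)
    also have "\<dots> = u x" using eq[OF that] \<open>c u \<noteq> 0\<close>
      by (simp add: add_eq_0_iff2 field_simps)
    finally show ?thesis by simp
  qed
  then show ?thesis by (intro exI[of _ "\<lambda>v. - c v / c u"]) blast
qed

definition cols :: "'a set \<Rightarrow> 'a cmat \<Rightarrow> 'a cvec set" where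
  "cols \<Omega> A = {(\<lambda>x. if x \<in> \<Omega> then A x y else 0) | y. y \<in> \<Omega>}"

text \<open>The \<open>Max\<close> in \<open>mrank\<close> is attained: there are finitely many
  columns, and \<open>{}\<close> makes the set of candidates nonempty.\<close>

lemma mrank_basis:
  assumes "finite \<Omega>"
  obtains V where "V \<subseteq> cols \<Omega> A" "lin_indep \<Omega> V" "card V = mrank \<Omega> A"
    "\<And>U. U \<subseteq> cols \<Omega> A \<Longrightarrow> lin_indep \<Omega> U \<Longrightarrow> card U \<le> card V"
proof -
  let ?M = "{card V | V. V \<subseteq> cols \<Omega> A \<and> lin_indep \<Omega> V}"
  have finC: "finite (cols \<Omega> A)" using assms by (simp add: cols_def)
  have "?M \<subseteq> card ` Pow (cols \<Omega> A)" by auto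
  then have finM: "finite ?M" using finC by (meson finite_Pow_iff finite_imageI finite_subset)
  have "card {} \<in> ?M" by (intro CollectI exI[of _ "{}"]) (auto simp: lin_indep_def)
  then have "Max ?M \<in> ?M" using finM by (intro Max_in) auto
  moreover have "mrank \<Omega> A = Max ?M" by (simp add: mrank_def cols_def)
  ultimately obtain V where V: "V \<subseteq> cols \<Omega> A" "lin_indep \<Omega> V" "card V = mrank \<Omega> A" by auto
  have "card U \<le> card V" if "U \<subseteq> cols \<Omega> A" "lin_indep \<Omega> U" for U
    using that finM V(3) \<open>mrank \<Omega> A = Max ?M\<close> by (auto intro!: Max_ge)
  with V that show ?thesis by blast
qed

text \<open>With a column basis \<open>V\<close>, factor \<open>P = V F\<close>. Idempotence says
  that \<open>P\<close> fixes its columns, so \<open>F V\<close> is the identity by independence,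
  and \<open>tr (V F) = tr (F V)\<close> is the size of \<open>V\<close>.\<close>

lemma mtrace_idempotent:
  assumes fin: "finite \<Omega>" and idem: "mmult \<Omega> P P = P"
  shows "mtrace \<Omega> P = of_nat (mrank \<Omega> P)"
proof -
  obtain V where V: "V \<subseteq> cols \<Omega> P" "lin_indep \<Omega> V" "card V = mrank \<Omega> P"
    and max: "\<And>U. U \<subseteq> cols \<Omega> P \<Longrightarrow> lin_indep \<Omega> U \<Longrightarrow> card U \<le> card V"
    using mrank_basis[OF fin] by metis
  have finV: "finite V" using V by (simp add: lin_indep_def)
  have "\<exists>f. \<forall>x\<in>\<Omega>. u x = (\<Sum>v\<in>V. f v * v x)" if "u \<in> cols \<Omega> P" for u
  proof (rule maximal_lin_indep_spans[OF V(2)])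
    show "u \<in> V \<or> \<not> lin_indep \<Omega> (insert u V)"
      using max[of "insert u V"] that V(1) finV by auto
  qed
  then have "\<forall>y\<in>\<Omega>. \<exists>f. \<forall>x\<in>\<Omega>. P x y = (\<Sum>v\<in>V. f v * v x)"
    by (fastforce simp: cols_def)
  then obtain F where F: "\<And>x y. x \<in> \<Omega> \<Longrightarrow> y \<in> \<Omega> \<Longrightarrow> P x y = (\<Sum>v\<in>V. F y v * v x)"
    by metis
  \<comment> \<open>The matrix of the product \<open>F V\<close>, with rows and columns indexed by
    the basis.\<close>
  define H where "H w v = (\<Sum>y\<in>\<Omega>. F y w * v y)" for w v
  have H: "H w v = (if w = v then 1 else 0)" if "v \<in> V" "w \<in> V" for v w
  proof -
    have Pv: "(\<Sum>y\<in>\<Omega>. P x y * v y) = v x" if "x \<in> \<Omega>" for x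
    proof -
      obtain z where z: "z \<in> \<Omega>" "v = (\<lambda>x. if x \<in> \<Omega> then P x z else 0)"
        using \<open>v \<in> V\<close> V(1) by (auto simp: cols_def)
      have "mmult \<Omega> P P x z = P x z" by (simp add: idem)
      then show ?thesis using that z by (simp add: mmult_def)
    qed
    have "(\<Sum>u\<in>V. (H u v - (if u = v then 1 else 0)) * u x) = 0" if "x \<in> \<Omega>" for x
    proof -
      have "v x = (\<Sum>y\<in>\<Omega>. \<Sum>u\<in>V. F y u * u x * v y)"
        using Pv[OF that] F[OF that] by (simp add: sum_distrib_right)
      also have "\<dots> = (\<Sum>u\<in>V. H u v * u x)"
        by (subst sum.swap) (simp add: H_def sum_distrib_left mult_ac)
      finally have "v x = (\<Sum>u\<in>V. H u v * u x)" .
      moreover have "(\<Sum>u\<in>V. (if u = v then 1 else 0) * u x) = v x"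
        using \<open>v \<in> V\<close> finV by (simp add: if_distrib[of "\<lambda>a. a * _"] sum.delta cong: if_cong)
      ultimately show ?thesis by (simp only: left_diff_distrib sum_subtractf) simp
    qed
    then have "\<forall>u\<in>V. H u v - (if u = v then 1 else 0) = 0"
      using V(2) unfolding lin_indep_def by (elim conjE allE[of _ "\<lambda>u. H u v - (if u = v then 1 else 0)"]) blast
    with that show ?thesis by auto
  qed
  have "mtrace \<Omega> P = (\<Sum>x\<in>\<Omega>. \<Sum>v\<in>V. F x v * v x)"
    by (simp add: mtrace_def F)
  also have "\<dots> = (\<Sum>v\<in>V. H v v)"
    by (subst sum.swap) (simp add: H_def)
  also have "\<dots> = of_nat (card V)" by (simp add: H)
  finally show ?thesis by (simp add: V(3))
qed

lemma mrank_eq_0D: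
  assumes "finite \<Omega>" and "mrank \<Omega> A = 0" and "x \<in> \<Omega>" "y \<in> \<Omega>"
  shows "A x y = 0"
proof (rule ccontr)
  assume nz: "A x y \<noteq> 0"
  let ?u = "\<lambda>x. if x \<in> \<Omega> then A x y else 0"
  obtain V where "V \<subseteq> cols \<Omega> A" "lin_indep \<Omega> V" "card V = mrank \<Omega> A"
    and max: "\<And>U. U \<subseteq> cols \<Omega> A \<Longrightarrow> lin_indep \<Omega> U \<Longrightarrow> card U \<le> card V"
    using mrank_basis[OF assms(1), of A] by blast
  moreover have "lin_indep \<Omega> {?u}" using nz assms(3) by (auto simp: lin_indep_def)
  moreover have "{?u} \<subseteq> cols \<Omega> A" using assms(4) by (auto simp: cols_def)
  ultimately have "card {?u} \<le> mrank \<Omega> A" by metis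
  then show False using assms(2) by simp
qed

text \<open>The vectors \<open>a v\<close> and \<open>b v\<close> satisfy the relation with
  coefficients \<open>b\<close> and \<open>- a\<close>. The resulting bound on cardinalities also
  makes the \<open>Max\<close> in \<open>sdim\<close> one over a finite set, although the line is
  infinite.\<close>

lemma sdim_line:
  assumes "x \<in> \<Omega>" "v x \<noteq> 0"
  shows "sdim \<Omega> {(\<lambda>x. c * v x) | c. True} = 1"
proof -
  let ?W = "{(\<lambda>x. c * v x) | c. True}"
  let ?M = "{card V | V. V \<subseteq> ?W \<and> lin_indep \<Omega> V}"
  have le: "card V \<le> 1" if V: "V \<subseteq> ?W" "lin_indep \<Omega> V" for V
  proof (rule ccontr)
    assume "\<not> card V \<le> 1"
    have fin: "finite V" using V by (simp add: lin_indep_def)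
    obtain u w where uw: "u \<in> V" "w \<in> V" "u \<noteq> w"
      using \<open>\<not> card V \<le> 1\<close> fin by (metis One_nat_def card_le_Suc0_iff_eq)
    then obtain a b where ab: "u = (\<lambda>x. a * v x)" "w = (\<lambda>x. b * v x)" using V(1) by blast
    define d where "d z = (if z = u then b else if z = w then - a else 0)" for z
    have "(\<Sum>z\<in>V. d z * z y) = (\<Sum>z\<in>{u,w}. d z * z y)" for y
      using uw fin by (intro sum.mono_neutral_right) (auto simp: d_def)
    then have "(\<Sum>z\<in>V. d z * z y) = 0" for y using uw(3) by (simp add: d_def) (simp add: ab)
    then have "\<forall>z\<in>V. d z = 0" using V(2) unfolding lin_indep_def by blast
    then have "d u = 0" "d w = 0" using uw by auto
    then have "a = 0" "b = 0" using uw(3) by (auto simp: d_def)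
    then show False using ab uw(3) by simp
  qed
  have "lin_indep \<Omega> {v}" using assms by (auto simp: lin_indep_def)
  moreover have "v \<in> ?W" by (intro CollectI exI[of _ 1]) auto
  ultimately have "card {v} \<in> ?M" by blast
  then have "1 \<in> ?M" by simp
  have "Max ?M = 1"
  proof (rule Max_eqI)
    have "?M \<subseteq> {..1}" using le by blast
    then show "finite ?M" by (rule finite_subset) simp
  qed (use le \<open>1 \<in> ?M\<close> in auto)
  then show ?thesis by (simp add: sdim_def)
qed

section \<open>The adjacency algebra of a scheme\<close>

text \<open>Replaces the span by a pointwise condition. It speaks of a mere partition so that it
  applies to the merged relations before they are known to form a scheme.\<close>

lemma mem_adj_algebra_iff:
  assumes fin: "finite \<Omega>" and part: "partition_of (\<Omega> \<times> \<Omega>) S"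
  shows "X \<in> adj_algebra S \<longleftrightarrow>
    (\<forall>x y. x \<notin> \<Omega> \<or> y \<notin> \<Omega> \<longrightarrow> X x y = 0) \<and>
    (\<forall>s\<in>S. \<forall>x y x' y'. (x, y) \<in> s \<longrightarrow> (x', y') \<in> s \<longrightarrow> X x y = X x' y')"
    (is "_ \<longleftrightarrow> ?supp \<and> ?const")
proof -
  have sub: "s \<subseteq> \<Omega> \<times> \<Omega>" if "s \<in> S" for s using part that by (auto simp: partition_of_def)
  have finS: "finite S" using sub fin by (intro finite_subset[of S "Pow (\<Omega> \<times> \<Omega>)"]) auto
  have uniq: "r = s" if "r \<in> S" "s \<in> S" "p \<in> r" "p \<in> s" for r s p
    using part that unfolding partition_of_def by blast
  have val: "(\<Sum>s\<in>S. c s * adj s x y) = c t" if "t \<in> S" "(x, y) \<in> t" for c t x y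
  proof -
    have "(\<Sum>s\<in>S. c s * adj s x y) = (\<Sum>s\<in>S. if s = t then c t else 0)"
      using that uniq by (intro sum.cong) (auto simp: adj_def)
    also have "\<dots> = c t" using finS that by simp
    finally show ?thesis .
  qed
  have outside: "(\<Sum>s\<in>S. c s * adj s x y) = 0" if "x \<notin> \<Omega> \<or> y \<notin> \<Omega>" for c x y
    using that sub by (intro sum.neutral) (auto simp: adj_def)
  show ?thesis
  proof
    assume "X \<in> adj_algebra S"
    then obtain c where "X = (\<lambda>x y. \<Sum>s\<in>S. c s * adj s x y)" by (auto simp: adj_algebra_def)
    then show "?supp \<and> ?const" using val outside by simp
  next
    assume X: "?supp \<and> ?const"
    define c where "c s = (case SOME p. p \<in> s of (x, y) \<Rightarrow> X x y)" for s
    have "X x y = (\<Sum>s\<in>S. c s * adj s x y)" for x y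
    proof (cases "x \<in> \<Omega> \<and> y \<in> \<Omega>")
      case False
      then show ?thesis using X outside by auto
    next
      case True
      then obtain t where t: "t \<in> S" "(x, y) \<in> t"
        using part unfolding partition_of_def by blast
      obtain x' y' where p: "(SOME p. p \<in> t) = (x', y')" by fastforce
      then have "(x', y') \<in> t" using t by (metis someI)
      then have "X x y = X x' y'" using X t by blast
      then have "c t = X x y" using p by (simp add: c_def)
      then show ?thesis using val t by simp
    qed
    then have "X = (\<lambda>x y. \<Sum>s\<in>S. c s * adj s x y)" by blast
    then show "X \<in> adj_algebra S" unfolding adj_algebra_def by blast
  qed
qed

lemma adj_mem_adj_algebra:
  assumes "finite \<Omega>" and part: "partition_of (\<Omega> \<times> \<Omega>) S" and s: "s \<in> S"
  shows "adj s \<in> adj_algebra S"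
  unfolding mem_adj_algebra_iff[OF assms(1,2)]
proof (intro conjI allI ballI impI)
  have sub: "s \<subseteq> \<Omega> \<times> \<Omega>" using part s by (auto simp: partition_of_def)
  show "adj s x y = 0" if "x \<notin> \<Omega> \<or> y \<notin> \<Omega>" for x y
    using sub that by (auto simp: adj_def)
  show "adj s x y = adj s x' y'" if "r \<in> S" "(x, y) \<in> r" "(x', y') \<in> r" for r x y x' y'
  proof -
    have "r = s \<or> r \<inter> s = {}" using part s that(1) unfolding partition_of_def by blast
    then show ?thesis using that by (auto simp: adj_def)
  qed
qed

text \<open>Reading the entry at a chosen representative makes \<open>coef\<close> linear in
  \<open>X\<close> without any side condition; for \<open>X\<close> in the algebra it is the
  coefficient of \<open>adj s\<close>. The representative is the same one that
  \<open>inter_num\<close> uses.\<close>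

definition coef :: "'a cmat \<Rightarrow> 'a rel \<Rightarrow> complex" where
  "coef X s = (case SOME p. p \<in> s of (x, y) \<Rightarrow> X x y)"

lemma coef_add: "coef (X + Y) s = coef X s + coef Y s"
  and coef_smul [simp]: "coef (c \<odot> X) s = c * coef X s"
  and coef_sum: "coef (\<Sum>i\<in>I. F i) s = (\<Sum>i\<in>I. coef (F i) s)"
  by (auto simp: coef_def sum_mat_apply split: prod.splits)

lemma mmult_adj:
  assumes "finite \<Omega>" "r \<subseteq> \<Omega> \<times> \<Omega>"
  shows "mmult \<Omega> (adj r) (adj s) x z = of_nat (card {y. (x, y) \<in> r \<and> (y, z) \<in> s})"
proof -
  have "mmult \<Omega> (adj r) (adj s) x z = (\<Sum>y\<in>\<Omega>. if (x, y) \<in> r \<and> (y, z) \<in> s then 1 else 0)"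
    by (auto simp: mmult_def adj_def intro!: sum.cong)
  also have "\<dots> = of_nat (card {y \<in> \<Omega>. (x, y) \<in> r \<and> (y, z) \<in> s})"
    using assms(1) by (simp add: sum.If_cases Int_def)
  also have "{y \<in> \<Omega>. (x, y) \<in> r \<and> (y, z) \<in> s} = {y. (x, y) \<in> r \<and> (y, z) \<in> s}"
    using assms(2) by auto
  finally show ?thesis .
qed

text \<open>The product notation is attached to \<open>\<Omega>\<close> alone, so that it is shared by a scheme and its
  merged scheme.\<close>

locale points =
  fixes \<Omega> :: "'a set"
begin

abbreviation mprod :: "'a cmat \<Rightarrow> 'a cmat \<Rightarrow> 'a cmat" (infixl "\<bullet>" 76) where
  "A \<bullet> B \<equiv> mmult \<Omega> A B"

end

locale assoc_scheme = points \<Omega> for \<Omega> :: "'a set" +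
  fixes S :: "'a rel set"
  assumes scheme: "scheme \<Omega> S"
begin

abbreviation alg :: "'a cmat set" where "alg \<equiv> adj_algebra S"

abbreviation unit :: "'a cmat" where "unit \<equiv> adj (Id_on \<Omega>)"

text \<open>A path from \<open>x\<close> to itself along \<open>s\<close> and back is just a
  neighbour of \<open>x\<close>; taking the structure constant at the diagonal makes the number
  independent of \<open>x\<close> by coherence.\<close>

definition valency :: "'a rel \<Rightarrow> nat" where
  "valency s = inter_num s (converse s) (Id_on \<Omega>)"

lemma finite_points: "finite \<Omega>" and partition: "partition_of (\<Omega> \<times> \<Omega>) S"
  and Id_in: "Id_on \<Omega> \<in> S" and converse_in: "s \<in> S \<Longrightarrow> converse s \<in> S"
  using scheme by (auto simp: scheme_def coherent_configuration_def)

lemma class_nonempty: "s \<in> S \<Longrightarrow> s \<noteq> {}"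
  using partition by (auto simp: partition_of_def)

lemma class_subset: "s \<in> S \<Longrightarrow> s \<subseteq> \<Omega> \<times> \<Omega>"
  using partition by (auto simp: partition_of_def)

lemma class_exists: "x \<in> \<Omega> \<Longrightarrow> y \<in> \<Omega> \<Longrightarrow> \<exists>s\<in>S. (x, y) \<in> s"
  using partition by (auto simp: partition_of_def)

lemma class_unique: "r \<in> S \<Longrightarrow> s \<in> S \<Longrightarrow> p \<in> r \<Longrightarrow> p \<in> s \<Longrightarrow> r = s"
  using partition unfolding partition_of_def by blast

lemma finite_classes: "finite S"
  using class_subset finite_points by (intro finite_subset[of S "Pow (\<Omega> \<times> \<Omega>)"]) auto

lemma points_nonempty: "\<Omega> \<noteq> {}"
  using Id_in class_nonempty by fastforce

lemmas mem_alg_iff = mem_adj_algebra_iff[OF finite_points partition]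

lemma alg_support: "X \<in> alg \<Longrightarrow> x \<notin> \<Omega> \<or> y \<notin> \<Omega> \<Longrightarrow> X x y = 0"
  using mem_alg_iff by blast

lemma alg_constant:
  "X \<in> alg \<Longrightarrow> s \<in> S \<Longrightarrow> (x, y) \<in> s \<Longrightarrow> (x', y') \<in> s \<Longrightarrow> X x y = X x' y'"
  using mem_alg_iff by blast

lemma algI:
  assumes "\<And>x y. x \<notin> \<Omega> \<or> y \<notin> \<Omega> \<Longrightarrow> X x y = 0"
    and "\<And>s x y x' y'. s \<in> S \<Longrightarrow> (x, y) \<in> s \<Longrightarrow> (x', y') \<in> s \<Longrightarrow> X x y = X x' y'"
  shows "X \<in> alg"
  unfolding mem_alg_iff using assms by blast

lemma alg_add: "X \<in> alg \<Longrightarrow> Y \<in> alg \<Longrightarrow> X + Y \<in> alg"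
  by (rule algI) (auto simp: alg_support intro!: arg_cong2[where f = "(+)"] intro: alg_constant)

lemma alg_diff: "X \<in> alg \<Longrightarrow> Y \<in> alg \<Longrightarrow> X - Y \<in> alg"
  by (rule algI) (auto simp: alg_support intro!: arg_cong2[where f = "(-)"] intro: alg_constant)

lemma alg_smul: "X \<in> alg \<Longrightarrow> c \<odot> X \<in> alg"
  by (rule algI) (auto simp: alg_support intro: alg_constant)

lemma alg_sum: "(\<And>i. i \<in> I \<Longrightarrow> F i \<in> alg) \<Longrightarrow> (\<Sum>i\<in>I. F i) \<in> alg"
  by (rule algI) (auto simp: sum_mat_apply alg_support intro!: sum.neutral sum.cong intro: alg_constant)

lemmas alg_adj = adj_mem_adj_algebra[OF finite_points partition]

lemma alg_dagger: "X \<in> alg \<Longrightarrow> dagger X \<in> alg"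
  by (rule algI) (auto simp: dagger_def alg_support intro: alg_constant[OF _ converse_in])

lemma class_point: "s \<in> S \<Longrightarrow> (SOME p. p \<in> s) \<in> s"
  using class_nonempty by (simp add: some_in_eq)

lemma coef_apply: "X \<in> alg \<Longrightarrow> s \<in> S \<Longrightarrow> (x, y) \<in> s \<Longrightarrow> X x y = coef X s"
  using class_point[of s] by (auto simp: coef_def split: prod.splits intro: alg_constant)

lemma coef_adj: "r \<in> S \<Longrightarrow> s \<in> S \<Longrightarrow> coef (adj r) s = (if r = s then 1 else 0)"
  unfolding coef_def using class_point[of s] class_unique by (auto simp: adj_def split: prod.splits)

lemma alg_eqI:
  assumes "X \<in> alg" "Y \<in> alg" "\<And>s. s \<in> S \<Longrightarrow> coef X s = coef Y s"
  shows "X = Y"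
proof (intro ext)
  fix x y
  show "X x y = Y x y"
  proof (cases "x \<in> \<Omega> \<and> y \<in> \<Omega>")
    case True
    then obtain s where s: "s \<in> S" "(x, y) \<in> s" using class_exists by blast
    show ?thesis using coef_apply[OF assms(1) s] coef_apply[OF assms(2) s] assms(3)[OF s(1)] by simp
  next
    case False
    then show ?thesis using assms(1,2)[THEN alg_support, of x y] by simp
  qed
qed

lemma coef_combination:
  "t \<in> S \<Longrightarrow> coef (\<Sum>s\<in>S. c s \<odot> adj s) t = c t"
  by (simp add: coef_sum coef_adj finite_classes if_distrib[of "\<lambda>a. _ * a"] sum.delta cong: if_cong)

lemma alg_combination: "(\<Sum>s\<in>S. c s \<odot> adj s) \<in> alg"
  by (intro alg_sum alg_smul alg_adj)

lemma alg_expand: "X \<in> alg \<Longrightarrow> X = (\<Sum>s\<in>S. coef X s \<odot> adj s)"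
  by (rule alg_eqI) (simp_all add: alg_combination coef_combination)

lemma mmult_adj_class:
  assumes "r \<in> S" "s \<in> S" "t \<in> S" "(x, z) \<in> t"
  shows "(adj r \<bullet> adj s) x z = of_nat (inter_num r s t)"
proof -
  obtain x' z' where p: "(SOME p. p \<in> t) = (x', z')" by fastforce
  then have "(x', z') \<in> t" using class_point[OF assms(3)] by simp
  then have "card {y. (x, y) \<in> r \<and> (y, z) \<in> s} = card {y. (x', y) \<in> r \<and> (y, z') \<in> s}"
    using scheme assms unfolding scheme_def coherent_configuration_def by blast
  then show ?thesis
    using p by (simp add: mmult_adj[OF finite_points class_subset[OF assms(1)]] inter_num_def)
qed

lemma alg_mmult_adj: "r \<in> S \<Longrightarrow> s \<in> S \<Longrightarrow> adj r \<bullet> adj s \<in> alg"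
  unfolding mem_alg_iff
proof (intro conjI allI impI ballI)
  assume rs: "r \<in> S" "s \<in> S"
  fix x z assume "x \<notin> \<Omega> \<or> z \<notin> \<Omega>"
  then show "(adj r \<bullet> adj s) x z = 0"
    using rs[THEN class_subset] by (auto simp: mmult_def adj_def intro!: sum.neutral)
qed (simp add: mmult_adj_class)

lemma coef_mmult_adj:
  assumes "r \<in> S" "s \<in> S" "t \<in> S"
  shows "coef (adj r \<bullet> adj s) t = of_nat (inter_num r s t)"
  using mmult_adj_class[OF assms] class_point[OF assms(3)] by (auto simp: coef_def split: prod.splits)

lemma alg_mmult:
  assumes "X \<in> alg" "Y \<in> alg"
  shows "X \<bullet> Y \<in> alg"
proof -
  have "X \<bullet> Y = (\<Sum>r\<in>S. \<Sum>s\<in>S. (coef Y s * coef X r) \<odot> (adj r \<bullet> adj s))"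
    by (subst alg_expand[OF assms(1)], subst alg_expand[OF assms(2)])
      (simp add: mmult_sum_left mmult_sum_right smul_sum mult.commute, rule sum.swap)
  also have "\<dots> \<in> alg" by (intro alg_sum alg_smul alg_mmult_adj)
  finally show ?thesis .
qed

lemma unit_alg: "unit \<in> alg"
  by (intro alg_adj Id_in)

lemma unit_mmult:
  assumes "X \<in> alg"
  shows "unit \<bullet> X = X"
proof (intro ext)
  fix x y
  have "(unit \<bullet> X) x y = (\<Sum>z\<in>\<Omega>. if z = x then (if x \<in> \<Omega> then X x y else 0) else 0)"
    unfolding mmult_def by (rule sum.cong) (auto simp: adj_def)
  also have "\<dots> = X x y" using finite_points alg_support[OF assms] by (simp add: sum.delta)
  finally show "(unit \<bullet> X) x y = X x y" .
qed

lemma mmult_unit: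
  assumes "X \<in> alg"
  shows "X \<bullet> unit = X"
proof (intro ext)
  fix x y
  have "(X \<bullet> unit) x y = (\<Sum>z\<in>\<Omega>. if z = y then X x y else 0)"
    by (auto simp: mmult_def adj_def intro!: sum.cong)
  also have "\<dots> = X x y" using finite_points alg_support[OF assms] by (simp add: sum.delta)
  finally show "(X \<bullet> unit) x y = X x y" .
qed

lemma row_sum_adj:
  assumes "s \<in> S" "x \<in> \<Omega>"
  shows "(\<Sum>y\<in>\<Omega>. adj s x y) = of_nat (valency s)"
proof -
  have "(adj s \<bullet> adj (converse s)) x x = of_nat (valency s)"
    unfolding valency_def using assms Id_in converse_in by (intro mmult_adj_class) auto
  moreover have "(adj s \<bullet> adj (converse s)) x x = (\<Sum>y\<in>\<Omega>. adj s x y)"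
    by (auto simp: mmult_def adj_def intro!: sum.cong)
  ultimately show ?thesis by simp
qed

lemma card_neighbours:
  assumes "s \<in> S" "x \<in> \<Omega>"
  shows "card {y. (x, y) \<in> s} = valency s"
proof -
  have "(adj s \<bullet> adj (converse s)) x x = of_nat (valency s)"
    unfolding valency_def using assms Id_in converse_in by (intro mmult_adj_class) auto
  then show ?thesis
    by (simp add: mmult_adj[OF finite_points class_subset[OF assms(1)]])
qed

lemma valency_pos:
  assumes "s \<in> S"
  shows "valency s > 0"
proof -
  obtain x y where xy: "(x, y) \<in> s" using class_nonempty[OF assms] by fastforce
  have "finite {y. (x, y) \<in> s}"
    using class_subset[OF assms] finite_points by (auto intro: finite_subset[of _ \<Omega>])
  then have "card {y. (x, y) \<in> s} > 0" using xy by (auto simp: card_gt_0_iff)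
  moreover have "x \<in> \<Omega>" using class_subset[OF assms] xy by auto
  ultimately show ?thesis using card_neighbours[OF assms] by simp
qed

section \<open>The trace form and the idempotent \<open>P0\<close>\<close>

lemma mtrace_alg:
  assumes "X \<in> alg"
  shows "mtrace \<Omega> X = of_nat (card \<Omega>) * coef X (Id_on \<Omega>)"
proof -
  have "mtrace \<Omega> X = (\<Sum>x\<in>\<Omega>. coef X (Id_on \<Omega>))"
    unfolding mtrace_def using coef_apply[OF assms Id_in] by (intro sum.cong) auto
  then show ?thesis by simp
qed

text \<open>If \<open>(x, y)\<close> is in \<open>r\<close> and \<open>(y, x)\<close> in
  \<open>s\<close>, then \<open>r\<close> meets \<open>converse s\<close> and the two classes
  coincide. Transposition is thereby expressed by structure constants, which algebraic automorphisms
  preserve.\<close>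

lemma inter_num_Id_eq_0_iff:
  assumes "r \<in> S" "s \<in> S"
  shows "inter_num r s (Id_on \<Omega>) = 0 \<longleftrightarrow> r \<noteq> converse s"
proof
  assume "inter_num r s (Id_on \<Omega>) = 0"
  then show "r \<noteq> converse s"
    using valency_pos[OF assms(1)] by (auto simp: valency_def)
next
  assume ne: "r \<noteq> converse s"
  obtain x where x: "x \<in> \<Omega>" using points_nonempty by blast
  have "{y. (x, y) \<in> r \<and> (y, x) \<in> s} = {}"
    using class_unique[OF assms(1) converse_in[OF assms(2)]] ne by auto
  then have "(adj r \<bullet> adj s) x x = 0"
    unfolding mmult_adj[OF finite_points class_subset[OF assms(1)]] by (simp only: card.empty of_nat_0)
  then show "inter_num r s (Id_on \<Omega>) = 0"
    using mmult_adj_class[OF assms Id_in, of x x] x by auto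
qed

text \<open>The adjacency matrices and their transposes are dual bases for the trace form, up to the
  factors \<open>n n_s\<close>.\<close>

lemma mtrace_mmult_adj:
  assumes "r \<in> S" "s \<in> S"
  shows "mtrace \<Omega> (adj r \<bullet> adj s) =
    (if r = converse s then of_nat (card \<Omega>) * of_nat (valency r) else 0)"
  using inter_num_Id_eq_0_iff[OF assms] assms
  by (auto simp: mtrace_alg[OF alg_mmult_adj[OF assms]] coef_mmult_adj Id_in valency_def)

lemma P0_conv: "P0 \<Omega> = (\<Sum>s\<in>S. (1 / of_nat (card \<Omega>)) \<odot> adj s)"
proof -
  have "P0 \<Omega> \<in> alg" by (rule algI) (use class_subset in \<open>auto simp: P0_def\<close>)
  moreover have "coef (P0 \<Omega>) s = 1 / of_nat (card \<Omega>)" if "s \<in> S" for s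
    using class_point[OF that] class_subset[OF that] by (auto simp: coef_def P0_def split: prod.splits)
  ultimately show ?thesis by (intro alg_eqI alg_combination) (auto simp: coef_combination)
qed

lemma P0_alg: "P0 \<Omega> \<in> alg"
  unfolding P0_conv by (rule alg_combination)

lemma P0_nonzero: "P0 \<Omega> \<noteq> 0"
proof
  assume "P0 \<Omega> = 0"
  moreover obtain x where "x \<in> \<Omega>" using points_nonempty by blast
  ultimately have "P0 \<Omega> x x = 0" by simp
  then show False using \<open>x \<in> \<Omega>\<close> finite_points by (auto simp: P0_def)
qed

lemma P0_idempotent: "P0 \<Omega> \<bullet> P0 \<Omega> = P0 \<Omega>"
  using points_nonempty finite_points by (auto simp: fun_eq_iff mmult_def P0_def)

text \<open>Each adjacency matrix has constant row sums, so the all-ones vector is a joint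
  eigenvector of the algebra.\<close>

lemma mmult_P0:
  assumes "X \<in> alg"
  shows "\<exists>c. X \<bullet> P0 \<Omega> = c \<odot> P0 \<Omega>"
proof -
  have "adj s \<bullet> P0 \<Omega> = of_nat (valency s) \<odot> P0 \<Omega>" if "s \<in> S" for s
  proof (intro ext)
    fix x z
    show "(adj s \<bullet> P0 \<Omega>) x z = (of_nat (valency s) \<odot> P0 \<Omega>) x z"
    proof (cases "x \<in> \<Omega> \<and> z \<in> \<Omega>")
      case True
      then show ?thesis
        using row_sum_adj[OF that, of x] by (simp add: mmult_def P0_def flip: sum_divide_distrib)
    next
      case False
      then show ?thesis
        using class_subset[OF that] by (auto simp: mmult_def P0_def adj_def intro!: sum.neutral)
    qed
  qed
  then have "X \<bullet> P0 \<Omega> = (\<Sum>s\<in>S. (coef X s * of_nat (valency s)) \<odot> P0 \<Omega>)"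
    by (subst alg_expand[OF assms]) (simp add: mmult_sum_left)
  also have "\<dots> = (\<Sum>s\<in>S. coef X s * of_nat (valency s)) \<odot> P0 \<Omega>"
    by (auto simp: fun_eq_iff sum_mat_apply sum_distrib_right)
  finally show ?thesis by blast
qed

end

section \<open>Primitive idempotents of a commutative scheme\<close>

lemma mvmult_mmult: "mvmult \<Omega> (mmult \<Omega> A B) v = mvmult \<Omega> A (mvmult \<Omega> B v)"
proof (intro ext)
  fix x
  have "mvmult \<Omega> (mmult \<Omega> A B) v x = (\<Sum>y\<in>\<Omega>. \<Sum>z\<in>\<Omega>. A x z * B z y * v y)"
    by (simp add: mvmult_def mmult_def sum_distrib_right)
  also have "\<dots> = (\<Sum>z\<in>\<Omega>. \<Sum>y\<in>\<Omega>. A x z * B z y * v y)" by (rule sum.swap)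
  finally show "mvmult \<Omega> (mmult \<Omega> A B) v x = mvmult \<Omega> A (mvmult \<Omega> B v) x"
    by (simp add: mvmult_def sum_distrib_left mult.assoc)
qed

lemma mvmult_smul: "mvmult \<Omega> (c \<odot> A) v = (\<lambda>x. c * mvmult \<Omega> A v x)"
  by (auto simp: fun_eq_iff mvmult_def sum_distrib_left mult.assoc)

lemma mvmult_scale: "mvmult \<Omega> A (\<lambda>x. c * v x) = (\<lambda>x. c * mvmult \<Omega> A v x)"
  by (auto simp: fun_eq_iff mvmult_def sum_distrib_left mult_ac)

locale comm_scheme = assoc_scheme +
  assumes commutative: "commutative_cc \<Omega> S"
begin

abbreviation idem :: "'a cmat \<Rightarrow> bool" where
  "idem E \<equiv> E \<in> alg \<and> E \<bullet> E = E"

abbreviation prim :: "'a cmat set" where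
  "prim \<equiv> central_primitive_idempotents \<Omega> S"

lemma mmult_commute: "X \<in> alg \<Longrightarrow> Y \<in> alg \<Longrightarrow> X \<bullet> Y = Y \<bullet> X"
  using commutative by (simp add: commutative_cc_def)

lemma central_idempotent_iff: "central_idempotent \<Omega> S E \<longleftrightarrow> idem E"
  using mmult_commute by (auto simp: central_idempotent_def)

lemma prim_iff:
  "P \<in> prim \<longleftrightarrow> idem P \<and> P \<noteq> 0 \<and>
    (\<forall>E F. idem E \<longrightarrow> idem F \<longrightarrow> E \<bullet> F = 0 \<longrightarrow> P = E + F \<longrightarrow> E = 0 \<or> F = 0)"
proof -
  have zero: "(\<lambda>x y. 0) = (0 :: 'a cmat)"
    by (auto simp: fun_eq_iff)
  have plus: "(\<lambda>x y. E x y + F x y) = E + F" for E F :: "'a cmat"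
    by (auto simp: fun_eq_iff)
  show ?thesis
    unfolding central_primitive_idempotents_def central_idempotent_iff mem_Collect_eq plus zero
    by blast
qed

lemma primD: "P \<in> prim \<Longrightarrow> P \<in> alg" "P \<in> prim \<Longrightarrow> P \<bullet> P = P" "P \<in> prim \<Longrightarrow> P \<noteq> 0"
  using prim_iff by blast+

lemma idem_complement:
  assumes "idem E" "idem P" "E \<bullet> P = E"
  shows "idem (P - E)" "E \<bullet> (P - E) = 0"
proof -
  have PE: "P \<bullet> E = E" using assms mmult_commute by metis
  show "E \<bullet> (P - E) = 0" using assms by (simp add: mmult_diff_right)
  have "(P - E) \<bullet> (P - E) = P - E - (E - E)"
    unfolding mmult_diff_left mmult_diff_right using assms PE by metis
  then show "idem (P - E)" using assms alg_diff by simp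
qed

lemma prim_minimal:
  assumes "P \<in> prim" "idem E" "E \<bullet> P = E"
  shows "E = 0 \<or> E = P"
proof -
  have "idem P" using primD assms by blast
  note c = idem_complement[OF assms(2) this assms(3)]
  have "P = E + (P - E)" by simp
  then have "E = 0 \<or> P - E = 0"
    using assms(1,2) c unfolding prim_iff by blast
  then show ?thesis by auto
qed

text \<open>If \<open>X\<^sup>2 = 0\<close> then the hermitian matrix \<open>H = X X\<^sup>*\<close> satisfies
  \<open>H H\<^sup>* = X\<^sup>2 (X\<^sup>*)\<^sup>2 = 0\<close>, so \<open>H = 0\<close> and \<open>X = 0\<close>.\<close>

lemma alg_reduced:
  assumes X: "X \<in> alg" and "X \<bullet> X = 0"
  shows "X = 0"
proof -
  let ?D = "dagger X"
  let ?H = "X \<bullet> ?D"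
  have D: "?D \<in> alg" using X by (rule alg_dagger)
  have H: "?H \<in> alg" using X D by (rule alg_mmult)
  have "dagger ?H = ?H" by (simp add: dagger_mmult)
  have "?H \<bullet> ?H = X \<bullet> (?D \<bullet> X) \<bullet> ?D" by (simp add: mmult_assoc)
  also have "\<dots> = (X \<bullet> X) \<bullet> (?D \<bullet> ?D)" using mmult_commute[OF D X] by (simp add: mmult_assoc)
  also have "\<dots> = 0" using assms(2) by simp
  finally have "?H \<bullet> dagger ?H = 0" unfolding \<open>dagger ?H = ?H\<close> .
  then have "?H = 0"
    using mmult_dagger_self_eq_0D[OF finite_points, of ?H] alg_support[OF H] by blast
  then show "X = 0"
    using mmult_dagger_self_eq_0D[OF finite_points, of X] alg_support[OF X] by blast
qed

text \<open>By commutativity the joint eigenspace for the relations treated so far, cut down by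
  \<open>P X = X\<close>, is invariant under multiplication by the next adjacency matrix, which
  therefore has an eigenmatrix inside it.\<close>

lemma common_eigenmatrix:
  assumes P: "P \<in> alg" "P \<bullet> P = P" "P \<noteq> 0" and "finite T" "T \<subseteq> S"
  shows "\<exists>X \<chi>. X \<in> alg \<and> X \<noteq> 0 \<and> P \<bullet> X = X \<and> (\<forall>s\<in>T. adj s \<bullet> X = \<chi> s \<odot> X)"
  using assms(4,5)
proof (induction T rule: finite_induct)
  case empty
  then show ?case using P by blast
next
  case (insert r T)
  have "T \<subseteq> S" using insert.prems by blast
  from insert.IH[OF this] obtain X \<chi> where X: "X \<in> alg" "X \<noteq> 0" "P \<bullet> X = X"
    and \<chi>: "\<And>s. s \<in> T \<Longrightarrow> adj s \<bullet> X = \<chi> s \<odot> X" by blast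
  define W where "W = {Y \<in> alg. P \<bullet> Y = Y \<and> (\<forall>s\<in>T. adj s \<bullet> Y = \<chi> s \<odot> Y)}"
  have r: "adj r \<in> alg" using insert.prems alg_adj by blast
  have comm: "A \<bullet> (adj r \<bullet> Y) = adj r \<bullet> (A \<bullet> Y)" if "A \<in> alg" for A Y
    using mmult_commute[OF that r] by (metis mmult_assoc)
  have "\<exists>u\<in>W. u \<noteq> 0 \<and> (\<exists>l. adj r \<bullet> u = l \<odot> u)"
  proof (rule eigenmatrix_exists[where L = "\<lambda>Y. adj r \<bullet> Y", OF finite_points])
    show "A x y = 0" if "A \<in> W" "x \<notin> \<Omega> \<or> y \<notin> \<Omega>" for A x y
      using that alg_support by (auto simp: W_def)
    show "A + B \<in> W" if "A \<in> W" "B \<in> W" for A B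
      using that by (auto simp: W_def alg_add mmult_add_right smul_add_right)
    show "c \<odot> A \<in> W" if "A \<in> W" for c A
      using that by (auto simp: W_def alg_smul mult.commute)
    show "adj r \<bullet> A \<in> W" if "A \<in> W" for A
    proof -
      have "adj s \<in> alg" if "s \<in> T" for s using that insert.prems alg_adj by blast
      then show ?thesis using that r P(1) by (auto simp: W_def alg_mmult comm)
    qed
    show "X \<in> W" using X \<chi> by (auto simp: W_def)
  qed (use X in \<open>simp_all add: mmult_add_right\<close>)
  then obtain u l where u: "u \<in> W" "u \<noteq> 0" "adj r \<bullet> u = l \<odot> u" by blast
  then have "\<forall>s\<in>insert r T. adj s \<bullet> u = (\<chi>(r := l)) s \<odot> u"
    using insert.hyps by (auto simp: W_def)
  with u show ?case unfolding W_def by blast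
qed

text \<open>A common eigenmatrix \<open>X\<close> of all adjacency matrices with \<open>P X = X\<close> satisfies \<open>X\<^sup>2 = c X\<close> with
  \<open>c \<noteq> 0\<close>, so \<open>X / c\<close> is an idempotent below \<open>P\<close>.\<close>

lemma prim_scalar_adj:
  assumes "P \<in> prim"
  shows "\<exists>\<chi>. \<forall>s\<in>S. adj s \<bullet> P = \<chi> s \<odot> P"
proof -
  note P = primD[OF assms]
  obtain X \<chi> where X: "X \<in> alg" "X \<noteq> 0" "P \<bullet> X = X" and \<chi>: "\<forall>s\<in>S. adj s \<bullet> X = \<chi> s \<odot> X"
    using common_eigenmatrix[OF P finite_classes] by auto
  define c where "c = (\<Sum>s\<in>S. coef X s * \<chi> s)"
  have "X \<bullet> X = (\<Sum>s\<in>S. coef X s \<odot> (adj s \<bullet> X))"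
    by (subst (1) alg_expand[OF X(1)]) (simp add: mmult_sum_left)
  also have "\<dots> = (\<Sum>s\<in>S. (coef X s * \<chi> s) \<odot> X)" using \<chi> by simp
  also have "\<dots> = c \<odot> X" by (auto simp: fun_eq_iff c_def sum_mat_apply sum_distrib_right)
  finally have XX: "X \<bullet> X = c \<odot> X" .
  have "c \<noteq> 0" using alg_reduced[OF X(1)] XX X(2) by auto
  let ?E = "(1 / c) \<odot> X"
  have "idem ?E" using X(1) XX \<open>c \<noteq> 0\<close> by (simp add: alg_smul)
  moreover have "?E \<bullet> P = ?E" using X(3) mmult_commute[OF X(1) P(1)] by simp
  moreover have "?E \<noteq> 0" using X(2) \<open>c \<noteq> 0\<close> by simp
  ultimately have "?E = P" using prim_minimal[OF assms] by blast
  moreover have "adj s \<bullet> ?E = \<chi> s \<odot> ?E" if "s \<in> S" for s using \<chi> that by (simp add: mult.commute)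
  ultimately show ?thesis by metis
qed

text \<open>As a function of \<open>X\<close> this is the linear character of the algebra attached
  to the primitive idempotent \<open>P\<close>.\<close>

definition eigval :: "'a cmat \<Rightarrow> 'a cmat \<Rightarrow> complex" where
  "eigval P X = (SOME c. X \<bullet> P = c \<odot> P)"

lemma prim_mmult:
  assumes "P \<in> prim" "X \<in> alg"
  shows "X \<bullet> P = eigval P X \<odot> P"
proof -
  obtain \<chi> where "\<forall>s\<in>S. adj s \<bullet> P = \<chi> s \<odot> P" using prim_scalar_adj[OF assms(1)] by blast
  then have "X \<bullet> P = (\<Sum>s\<in>S. (coef X s * \<chi> s) \<odot> P)"
    by (subst alg_expand[OF assms(2)]) (simp add: mmult_sum_left)
  also have "\<dots> = (\<Sum>s\<in>S. coef X s * \<chi> s) \<odot> P"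
    by (auto simp: fun_eq_iff sum_mat_apply sum_distrib_right)
  finally show ?thesis unfolding eigval_def by (rule someI)
qed

lemma prim_orthogonal:
  assumes "P \<in> prim" "Q \<in> prim" "P \<noteq> Q"
  shows "P \<bullet> Q = 0"
proof -
  note P = primD[OF assms(1)] and Q = primD[OF assms(2)]
  have PQ: "P \<bullet> Q = Q \<bullet> P" by (rule mmult_commute[OF P(1) Q(1)])
  have "P \<bullet> Q \<bullet> (P \<bullet> Q) = (P \<bullet> P) \<bullet> (Q \<bullet> Q)" using PQ by (metis mmult_assoc)
  then have "idem (P \<bullet> Q)" using P Q alg_mmult by simp
  moreover have "P \<bullet> Q \<bullet> P = P \<bullet> Q" using PQ P(2) by (metis mmult_assoc)
  moreover have "P \<bullet> Q \<bullet> Q = P \<bullet> Q" using Q(2) by (simp add: mmult_assoc)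
  ultimately show ?thesis using prim_minimal[OF assms(1)] prim_minimal[OF assms(2)] assms(3) by metis
qed

section \<open>Irreducible submodules are lines\<close>

lemma line_submodule:
  assumes P: "P \<in> prim" and v: "v \<in> cvecs \<Omega>" "mvmult \<Omega> P v = v"
  shows "submodule \<Omega> S {(\<lambda>x. c * v x) | c. True}"
proof -
  \<comment> \<open>Here \<open>A v = A P v\<close>, and \<open>A P\<close> is a multiple of
    \<open>P\<close>.\<close>
  have act: "mvmult \<Omega> A v = (\<lambda>x. eigval P A * v x)" if "A \<in> alg" for A
    using mvmult_mmult[of \<Omega> A P v] prim_mmult[OF P that] v(2) by (simp add: mvmult_smul)
  show ?thesis
    unfolding submodule_def
  proof (intro conjI ballI allI)
    let ?W = "{(\<lambda>x. c * v x) | c. True}"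
    show "?W \<subseteq> cvecs \<Omega>" using v(1) by (auto simp: cvecs_def)
    show "(\<lambda>x. 0) \<in> ?W" by (auto intro: exI[of _ 0])
    show "(\<lambda>x. u x + w x) \<in> ?W" if "u \<in> ?W" "w \<in> ?W" for u w
      using that by (auto simp: fun_eq_iff simp flip: distrib_right)
    show "(\<lambda>x. c * w x) \<in> ?W" if "w \<in> ?W" for w c
      using that by (auto simp: fun_eq_iff simp flip: mult.assoc)
    show "mvmult \<Omega> A w \<in> ?W" if "A \<in> alg" "w \<in> ?W" for A w
    proof -
      obtain c where "w = (\<lambda>x. c * v x)" using \<open>w \<in> ?W\<close> by blast
      then have "mvmult \<Omega> A w = (\<lambda>x. (c * eigval P A) * v x)"
        using act[OF \<open>A \<in> alg\<close>] by (simp add: mvmult_scale mult.assoc)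
      then show ?thesis by blast
    qed
  qed
qed

text \<open>Since \<open>n_P\<close> is a choice among dimensions, two facts are required: every
  irreducible submodule for \<open>P\<close> is a line, and at least one exists.\<close>

lemma n_P_eq_1:
  assumes P: "P \<in> prim"
  shows "n_P \<Omega> S P = 1"
proof -
  have nonzero: "\<exists>x\<in>\<Omega>. v x \<noteq> 0" if "v \<in> cvecs \<Omega>" "v \<noteq> (\<lambda>x. 0)" for v
    using that by (fastforce simp: cvecs_def fun_eq_iff)
  have dim: "sdim \<Omega> W = 1" if "irreducible_for \<Omega> S P W" for W
  proof -
    have W: "submodule \<Omega> S W" "W \<noteq> {\<lambda>x. 0}" and PW: "\<And>v. v \<in> W \<Longrightarrow> mvmult \<Omega> P v = v"
      and irr: "\<And>U. submodule \<Omega> S U \<Longrightarrow> U \<subseteq> W \<Longrightarrow> U = {\<lambda>x. 0} \<or> U = W"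
      using that by (auto simp: irreducible_for_def irreducible_submodule_def)
    have W': "W \<subseteq> cvecs \<Omega>" "(\<lambda>x. 0) \<in> W" "\<And>v c. v \<in> W \<Longrightarrow> (\<lambda>x. c * v x) \<in> W"
      using W(1) by (auto simp: submodule_def)
    then obtain v where v: "v \<in> W" "v \<noteq> (\<lambda>x. 0)" using W(2) by blast
    then obtain x where x: "x \<in> \<Omega>" "v x \<noteq> 0" using nonzero W'(1) by blast
    let ?U = "{(\<lambda>x. c * v x) | c. True}"
    have "submodule \<Omega> S ?U" using line_submodule[OF P] v W'(1) PW by blast
    moreover have "?U \<subseteq> W" using W'(3) v(1) by blast
    moreover have "v \<in> ?U" by (auto intro: exI[of _ 1])
    ultimately have "W = ?U" using irr[of ?U] v(2) by blast
    then show ?thesis using sdim_line[of x \<Omega> v, OF x] by simp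
  qed
  have "\<exists>W. irreducible_for \<Omega> S P W"
  proof -
    \<comment> \<open>A nonzero column of \<open>P\<close> is fixed by \<open>P\<close> and spans
      the required submodule.\<close>
    obtain x y where xy: "P x y \<noteq> 0" using primD(3)[OF P] by (auto simp: fun_eq_iff)
    then have y: "x \<in> \<Omega>" "y \<in> \<Omega>" using alg_support[OF primD(1)[OF P]] by blast+
    define v where "v = (\<lambda>x. P x y)"
    have v: "v \<in> cvecs \<Omega>" "v x \<noteq> 0"
      using alg_support[OF primD(1)[OF P]] xy by (auto simp: v_def cvecs_def)
    have Pv: "mvmult \<Omega> P v = v"
    proof (intro ext)
      fix x
      have "(P \<bullet> P) x y = P x y" using primD(2)[OF P] by simp
      then show "mvmult \<Omega> P v x = v x" by (simp add: v_def mvmult_def mmult_def)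
    qed
    let ?W = "{(\<lambda>x. c * v x) | c. True}"
    have "U = {\<lambda>x. 0} \<or> U = ?W" if U: "submodule \<Omega> S U" "U \<subseteq> ?W" for U
    proof (cases "U = {\<lambda>x. 0}")
      case False
      moreover have "(\<lambda>x. 0) \<in> U" using U by (auto simp: submodule_def)
      ultimately obtain w where w: "w \<in> U" "w \<noteq> (\<lambda>x. 0)" by blast
      then obtain c where c: "w = (\<lambda>x. c * v x)" using U(2) by blast
      then have "c \<noteq> 0" using w(2) by auto
      have "(\<lambda>x. d * v x) \<in> U" for d
      proof -
        have "(\<lambda>x. (d / c) * w x) \<in> U" using U(1) w(1) unfolding submodule_def by blast
        then show ?thesis using c \<open>c \<noteq> 0\<close> by simp
      qed
      then show ?thesis using U(2) by blast
    qed simp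
    moreover have "?W \<noteq> {\<lambda>x. 0}"
    proof
      assume "?W = {\<lambda>x. 0}"
      moreover have "v \<in> ?W" by (auto intro: exI[of _ 1])
      ultimately have "v = (\<lambda>x. 0)" by blast
      then show False using v(2) by simp
    qed
    moreover have "mvmult \<Omega> P w = w" if "w \<in> ?W" for w
      using that by (auto simp: mvmult_scale Pv)
    ultimately have "irreducible_for \<Omega> S P ?W"
      unfolding irreducible_for_def irreducible_submodule_def
      using line_submodule[OF P v(1) Pv] by blast
    then show ?thesis by blast
  qed
  then have "\<exists>d W. irreducible_for \<Omega> S P W \<and> sdim \<Omega> W = d" by blast
  from someI_ex[OF this] show ?thesis unfolding n_P_def using dim by metis
qed

lemma mtrace_idem: "idem E \<Longrightarrow> mtrace \<Omega> E = of_nat (mrank \<Omega> E)"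
  using mtrace_idempotent[OF finite_points] by blast

lemma mrank_pos:
  assumes "idem E" "E \<noteq> 0"
  shows "mrank \<Omega> E > 0"
proof (rule ccontr)
  assume "\<not> mrank \<Omega> E > 0"
  then have "E x y = 0" for x y
    using mrank_eq_0D[OF finite_points] alg_support assms(1) by (cases "x \<in> \<Omega> \<and> y \<in> \<Omega>") auto
  then show False using assms(2) by (auto simp: fun_eq_iff)
qed

text \<open>A nonzero idempotent that is not primitive splits into two orthogonal nonzero ones, and
  both have smaller rank because the trace is additive. This serves as the decomposition into
  primitives.\<close>

lemma idem_induct [consumes 1, case_names zero prim add]:
  assumes "idem E" and "R 0" and "\<And>P. P \<in> prim \<Longrightarrow> R P"
    and "\<And>E F. idem E \<Longrightarrow> idem F \<Longrightarrow> E \<bullet> F = 0 \<Longrightarrow> R E \<Longrightarrow> R F \<Longrightarrow> R (E + F)"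
  shows "R E"
  using assms(1)
proof (induction "mrank \<Omega> E" arbitrary: E rule: less_induct)
  case less
  show ?case
  proof (cases "E = 0 \<or> E \<in> prim")
    case True
    then show ?thesis using assms(2,3) by blast
  next
    case False
    then obtain A B where AB: "idem A" "idem B" "A \<bullet> B = 0" "E = A + B" "A \<noteq> 0" "B \<noteq> 0"
      using less.prems unfolding prim_iff by blast
    have "(of_nat (mrank \<Omega> E) :: complex) = of_nat (mrank \<Omega> A + mrank \<Omega> B)"
      using AB(4) mtrace_idem[OF AB(1)] mtrace_idem[OF AB(2)] mtrace_idem[OF less.prems]
      by (simp add: mtrace_add)
    then have "mrank \<Omega> E = mrank \<Omega> A + mrank \<Omega> B" by (simp only: of_nat_eq_iff)
    then have "R A" "R B"
      using less.hyps AB mrank_pos by auto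
    then show ?thesis using assms(4) AB by blast
  qed
qed

text \<open>Both parts of a splitting of \<open>P0\<close> are scalar multiples of it, and their
  orthogonality forces one of the scalars to vanish.\<close>

lemma P0_prim: "P0 \<Omega> \<in> prim"
  unfolding prim_iff
proof (intro conjI allI impI)
  fix E F assume E: "idem E" and F: "idem F" and EF: "E \<bullet> F = 0" and sum: "P0 \<Omega> = E + F"
  obtain c where c: "E \<bullet> P0 \<Omega> = c \<odot> P0 \<Omega>" using mmult_P0 E by blast
  obtain d where d: "F \<bullet> P0 \<Omega> = d \<odot> P0 \<Omega>" using mmult_P0 F by blast
  have FE: "F \<bullet> E = 0" using EF E F mmult_commute by metis
  have "E \<bullet> P0 \<Omega> = E" "F \<bullet> P0 \<Omega> = F"
    using E F EF FE by (simp_all add: sum mmult_add_right)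
  then have E': "E = c \<odot> P0 \<Omega>" and F': "F = d \<odot> P0 \<Omega>" using c d by auto
  have "(c * d) \<odot> P0 \<Omega> = 0" using EF unfolding E' F' by (simp add: P0_idempotent mult.commute)
  then have "c = 0 \<or> d = 0" using P0_nonzero by simp
  then show "E = 0 \<or> F = 0" using E' F' by auto
qed (simp_all add: P0_alg P0_idempotent P0_nonzero)

text \<open>Coefficients are read off from traces: \<open>tr (P A\<^bsub>s*\<^esub>)\<close> is \<open>n n\<^sub>s\<close> times the
  coefficient of \<open>A\<^sub>s\<close> in \<open>P\<close>, and it is also \<open>\<chi>(s*) tr P\<close>.\<close>

lemma coef_prim:
  assumes P: "P \<in> prim" and s: "s \<in> S"
  shows "coef P s * (of_nat (card \<Omega>) * of_nat (valency s)) =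
    eigval P (adj (converse s)) * of_nat (mrank \<Omega> P)"
proof -
  note Pd = primD[OF P]
  have s': "converse s \<in> S" using s by (rule converse_in)
  have "mtrace \<Omega> (adj (converse s) \<bullet> P) = eigval P (adj (converse s)) * of_nat (mrank \<Omega> P)"
    using prim_mmult[OF P alg_adj[OF s']] mtrace_idem Pd by simp
  moreover have "mtrace \<Omega> (adj (converse s) \<bullet> P) = (\<Sum>r\<in>S. coef P r * mtrace \<Omega> (adj r \<bullet> adj (converse s)))"
  proof -
    have "adj (converse s) \<bullet> P = P \<bullet> adj (converse s)" by (rule mmult_commute[OF alg_adj[OF s'] Pd(1)])
    also have "\<dots> = (\<Sum>r\<in>S. coef P r \<odot> (adj r \<bullet> adj (converse s)))"
      by (subst alg_expand[OF Pd(1)]) (simp add: mmult_sum_left)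
    finally show ?thesis by (simp add: mtrace_sum)
  qed
  moreover have "(\<Sum>r\<in>S. coef P r * mtrace \<Omega> (adj r \<bullet> adj (converse s)))
      = (\<Sum>r\<in>S. if r = s then coef P s * (of_nat (card \<Omega>) * of_nat (valency s)) else 0)"
    using s' by (intro sum.cong) (auto simp: mtrace_mmult_adj)
  ultimately show ?thesis using s finite_classes by simp
qed

end

section \<open>Algebraic automorphisms\<close>

definition act :: "'a rel set \<Rightarrow> ('a rel \<Rightarrow> 'a rel) \<Rightarrow> 'a cmat \<Rightarrow> 'a cmat" where
  "act S g X = (\<Sum>s\<in>S. coef X s \<odot> adj (g s))"

lemma act_add: "act S g (X + Y) = act S g X + act S g Y"
  by (simp only: act_def coef_add smul_add_left sum.distrib)

lemma act_smul: "act S g (c \<odot> X) = c \<odot> act S g X"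
  by (simp add: act_def smul_sum)

lemma act_zero [simp]: "act S g 0 = 0"
  using act_smul[of S g 0 0] by simp

lemma act_sum: "act S g (\<Sum>i\<in>I. F i) = (\<Sum>i\<in>I. act S g (F i))"
  using sum_comp_morphism[of "act S g" F I] by (simp add: act_add o_def)

context assoc_scheme
begin

lemma adj_inject:
  assumes "r \<in> S" "s \<in> S" "adj r = adj s"
  shows "r = s"
proof -
  have "coef (adj r) r = coef (adj s) r" unfolding assms(3) ..
  then show ?thesis
    using coef_adj[OF assms(1,1)] coef_adj[OF assms(2,1)] by (auto split: if_splits)
qed

context
  fixes g assumes aut: "algebraic_automorphism S g"
begin

lemma aut_bij: "bij_betw g S S"
  using aut by (simp add: algebraic_automorphism_def)

lemma aut_in: "s \<in> S \<Longrightarrow> g s \<in> S"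
  using aut_bij by (rule bij_betwE[rule_format])

lemma aut_inj: "r \<in> S \<Longrightarrow> s \<in> S \<Longrightarrow> g r = g s \<Longrightarrow> r = s"
  using aut_bij unfolding bij_betw_def by (blast dest: inj_onD)

lemma aut_surj: "t \<in> S \<Longrightarrow> \<exists>s\<in>S. t = g s"
  using aut_bij unfolding bij_betw_def by blast

lemma aut_inter_num:
  "r \<in> S \<Longrightarrow> s \<in> S \<Longrightarrow> t \<in> S \<Longrightarrow> inter_num (g r) (g s) (g t) = inter_num r s t"
  using aut by (simp add: algebraic_automorphism_def)

lemma act_alg: "act S g X \<in> alg"
  unfolding act_def by (intro alg_sum alg_smul alg_adj aut_in)

lemma coef_act:
  assumes "t \<in> S"
  shows "coef (act S g X) (g t) = coef X t"
proof -
  have "coef (act S g X) (g t) = (\<Sum>s\<in>S. if s = t then coef X t else 0)"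
    unfolding act_def coef_sum
  proof (rule sum.cong)
    fix s assume s: "s \<in> S"
    show "coef (coef X s \<odot> adj (g s)) (g t) = (if s = t then coef X t else 0)"
      using aut_inj[OF s assms] coef_adj[OF aut_in[OF s] aut_in[OF assms]] by auto
  qed simp
  then show ?thesis using assms finite_classes by simp
qed

lemma act_eqI:
  assumes "Y \<in> alg" "\<And>s. s \<in> S \<Longrightarrow> coef Y (g s) = coef X s"
  shows "act S g X = Y"
proof (rule alg_eqI[OF act_alg assms(1)])
  fix t assume "t \<in> S"
  then obtain s where "s \<in> S" "t = g s" using aut_surj by blast
  then show "coef (act S g X) t = coef Y t" using assms(2) coef_act by simp
qed

lemma act_adj:
  assumes "s \<in> S"
  shows "act S g (adj s) = adj (g s)"
proof (rule act_eqI)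
  show "coef (adj (g s)) (g r) = coef (adj s) r" if "r \<in> S" for r
    using assms that aut_inj[OF assms that] by (auto simp: coef_adj aut_in)
qed (intro alg_adj aut_in assms)

lemma act_mmult_adj:
  assumes "r \<in> S" "s \<in> S"
  shows "act S g (adj r \<bullet> adj s) = adj (g r) \<bullet> adj (g s)"
proof (rule act_eqI)
  show "coef (adj (g r) \<bullet> adj (g s)) (g t) = coef (adj r \<bullet> adj s) t" if "t \<in> S" for t
    using assms that by (simp add: coef_mmult_adj aut_in aut_inter_num)
qed (intro alg_mmult_adj aut_in assms)

lemma act_mmult:
  assumes "X \<in> alg" "Y \<in> alg"
  shows "act S g (X \<bullet> Y) = act S g X \<bullet> act S g Y"
proof -
  have XY: "X \<bullet> Y = (\<Sum>r\<in>S. coef X r \<odot> (\<Sum>s\<in>S. coef Y s \<odot> (adj r \<bullet> adj s)))"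
  proof -
    have "X \<bullet> Y = (\<Sum>r\<in>S. coef X r \<odot> (adj r \<bullet> Y))"
      by (subst alg_expand[OF assms(1)]) (simp add: mmult_sum_left)
    moreover have "adj r \<bullet> Y = (\<Sum>s\<in>S. coef Y s \<odot> (adj r \<bullet> adj s))" for r
      by (subst alg_expand[OF assms(2)]) (simp add: mmult_sum_right)
    ultimately show ?thesis by simp
  qed
  have "act S g (X \<bullet> Y) = (\<Sum>r\<in>S. coef X r \<odot> (\<Sum>s\<in>S. coef Y s \<odot> (adj (g r) \<bullet> adj (g s))))"
    unfolding XY act_sum act_smul by (intro sum.cong refl arg_cong2[where f = smul] act_mmult_adj)
  also have "\<dots> = act S g X \<bullet> act S g Y"
    by (simp only: act_def[of S g X] mmult_sum_left mmult_smul_left)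
      (simp only: act_def[of S g Y] mmult_sum_right mmult_smul_right)
  finally show ?thesis .
qed

text \<open>Uniqueness of the unit: if \<open>g s\<close> is the diagonal, then
  \<open>act S g (adj s)\<close> is the unit, and multiplying
  \<open>adj (g (Id_on \<Omega>))\<close> by it gives the image of \<open>unit\<close> times
  \<open>adj s\<close>, which is the unit again.\<close>

lemma aut_Id: "g (Id_on \<Omega>) = Id_on \<Omega>"
proof -
  obtain s where s: "s \<in> S" "Id_on \<Omega> = g s" using aut_surj Id_in by blast
  have "adj (g (Id_on \<Omega>)) = adj (g (Id_on \<Omega>)) \<bullet> unit"
    by (rule mmult_unit[symmetric]) (intro alg_adj aut_in Id_in)
  also have "\<dots> = act S g unit \<bullet> act S g (adj s)"
    unfolding act_adj[OF Id_in] act_adj[OF s(1)] s(2)[symmetric] ..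
  also have "\<dots> = act S g (adj s)"
    unfolding act_mmult[OF unit_alg alg_adj[OF s(1)], symmetric] unit_mmult[OF alg_adj[OF s(1)]] ..
  also have "\<dots> = unit" using s by (simp add: act_adj)
  finally show ?thesis by (rule adj_inject[rotated 2]) (intro aut_in Id_in)+
qed

lemma aut_converse:
  assumes "s \<in> S"
  shows "g (converse s) = converse (g s)"
proof -
  have s': "converse s \<in> S" using assms by (rule converse_in)
  have "inter_num (g (converse s)) (g s) (g (Id_on \<Omega>)) \<noteq> 0"
    using inter_num_Id_eq_0_iff[OF s' assms] by (simp add: aut_inter_num s' assms Id_in)
  then show ?thesis
    using inter_num_Id_eq_0_iff[OF aut_in[OF s'] aut_in[OF assms]] by (simp add: aut_Id)
qed

text \<open>The trace only sees the coefficient at the diagonal, and the diagonal is fixed.\<close>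

lemma mtrace_act: "X \<in> alg \<Longrightarrow> mtrace \<Omega> (act S g X) = mtrace \<Omega> X"
  using coef_act[OF Id_in, of X] by (simp add: mtrace_alg act_alg aut_Id)

lemma act_P0: "act S g (P0 \<Omega>) = P0 \<Omega>"
proof (rule act_eqI[OF P0_alg])
  show "coef (P0 \<Omega>) (g s) = coef (P0 \<Omega>) s" if "s \<in> S" for s
    unfolding P0_conv using that by (simp only: coef_combination aut_in)
qed

end

lemma act_act:
  assumes g: "algebraic_automorphism S g" and h: "algebraic_automorphism S h"
    and gh: "algebraic_automorphism S (g \<circ> h)" and X: "X \<in> alg"
  shows "act S g (act S h X) = act S (g \<circ> h) X"
  by (rule act_eqI[OF gh, symmetric])
    (simp_all add: act_alg[OF g] coef_act[OF g] coef_act[OF h] aut_in[OF h])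

lemma act_id: "X \<in> alg \<Longrightarrow> act S id X = X"
  unfolding act_def id_apply by (rule alg_expand[symmetric])

end

context comm_scheme
begin

text \<open>A splitting of the image is carried back by the inverse \<open>h\<close> to a splitting
  of \<open>P\<close>.\<close>

lemma act_prim:
  assumes g: "algebraic_automorphism S g" and h: "algebraic_automorphism S h"
    and hg: "h \<circ> g = id" and gh: "g \<circ> h = id" and P: "P \<in> prim"
  shows "act S g P \<in> prim"
  unfolding prim_iff
proof (intro conjI allI impI)
  note Pd = primD[OF P]
  have "algebraic_automorphism S id" by (simp add: algebraic_automorphism_def)
  then have inv: "act S h (act S g X) = X" "act S g (act S h X) = X" if "X \<in> alg" for X
    using act_act[OF h g _ that] act_act[OF g h _ that] act_id[OF that] by (simp_all add: hg gh)
  show "act S g P \<in> alg" by (rule act_alg[OF g])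
  show "act S g P \<bullet> act S g P = act S g P"
    using act_mmult[OF g Pd(1) Pd(1)] Pd(2) by simp
  show "act S g P \<noteq> 0" using inv(1)[OF Pd(1)] Pd(3) by auto
  fix E F assume E: "idem E" and F: "idem F" and EF: "E \<bullet> F = 0" and sum: "act S g P = E + F"
  have idem: "idem (act S h X)" if "idem X" for X
    using that act_mmult[OF h, of X X] act_alg[OF h] by simp
  have "act S h E \<bullet> act S h F = 0" using E F EF act_mmult[OF h, of E F] by simp
  moreover have "P = act S h E + act S h F"
    using inv(1)[OF Pd(1)] unfolding sum by (simp add: act_add)
  ultimately have "act S h E = 0 \<or> act S h F = 0"
    using P idem[OF E] idem[OF F] unfolding prim_iff by blast
  then show "E = 0 \<or> F = 0" using inv(2) E F act_zero by metis
qed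

text \<open>A primitive below one of two orthogonal summands is annihilated by the other, so it lies
  below their sum.\<close>

lemma idem_dominates_prim:
  assumes "idem E" "E \<noteq> 0"
  shows "\<exists>P\<in>prim. E \<bullet> P = P"
  using assms
proof (induction E rule: idem_induct)
  case (prim P)
  then show ?case using primD(2) by blast
next
  case (add E F)
  have FE: "F \<bullet> E = 0" using add mmult_commute by metis
  have *: "(E + F) \<bullet> P = P" if "E \<bullet> P = P" for P
  proof -
    have "F \<bullet> P = 0" using that FE by (metis mmult_assoc mmult_zero_left)
    then show ?thesis using that by (simp only: mmult_add_left add_0_right)
  qed
  have **: "(E + F) \<bullet> P = P" if "F \<bullet> P = P" for P
  proof -
    have "E \<bullet> P = 0" using that add(3) by (metis mmult_assoc mmult_zero_left)
    then show ?thesis using that by (simp only: mmult_add_left add_0_left)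
  qed
  show ?case
  proof (cases "E = 0")
    case True
    then have "F \<noteq> 0" using add(6) by auto
    then show ?thesis using add(5) ** by blast
  next
    case False
    then show ?thesis using add(4) * by blast
  qed
qed simp

text \<open>A version of Brauer's permutation lemma. For a primitive \<open>R\<close>, the trace of \<open>M R\<close> is
  \<open>|\<Omega>|\<close> if \<open>g\<close> fixes \<open>R\<close> and \<open>0\<close> otherwise, while the trace of \<open>M\<close> is \<open>|\<Omega>|\<close> times the number
  of basis relations fixed by \<open>g\<close>, which is \<open>1\<close>.\<close>

lemma fixed_prim_eq_P0:
  assumes g: "algebraic_automorphism S g" and h: "algebraic_automorphism S h"
    and hg: "h \<circ> g = id" and gh: "g \<circ> h = id"
    and free: "\<And>s. s \<in> S \<Longrightarrow> g s = s \<Longrightarrow> s = Id_on \<Omega>"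
    and P: "P \<in> prim" and fix_P: "act S g P = P"
  shows "P = P0 \<Omega>"
proof (rule ccontr)
  assume ne: "P \<noteq> P0 \<Omega>"
  let ?n = "of_nat (card \<Omega>) :: complex"
  let ?v = "\<lambda>s. of_nat (valency s) :: complex"
  \<comment> \<open>Each basis element \<open>adj s\<close> is sent to \<open>adj (g s)\<close> and
    paired with its dual for the trace form, scaled by the number of points.\<close>
  define M where "M = (\<Sum>s\<in>S. (1 / ?v s) \<odot> (adj (converse s) \<bullet> adj (g s)))"
  have v: "?v s \<noteq> 0" if "s \<in> S" for s using valency_pos[OF that] by simp
  have n: "?n \<noteq> 0" using finite_points points_nonempty by simp
  have M: "M \<in> alg"
    unfolding M_def by (intro alg_sum alg_smul alg_mmult_adj converse_in aut_in[OF g])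
  have "mtrace \<Omega> M = (\<Sum>s\<in>S. if s = Id_on \<Omega> then ?n else 0)"
    unfolding M_def mtrace_sum
  proof (rule sum.cong)
    fix s assume s: "s \<in> S"
    show "mtrace \<Omega> ((1 / ?v s) \<odot> (adj (converse s) \<bullet> adj (g s))) = (if s = Id_on \<Omega> then ?n else 0)"
    proof (cases "s = Id_on \<Omega>")
      case True
      then have "g s = s" "converse s = s" using aut_Id[OF g] by simp_all
      then show ?thesis using True v[OF s] mtrace_mmult_adj[OF s s] by simp
    next
      case False
      then have "converse s \<noteq> converse (g s)" using free[OF s] by (metis converse_converse)
      then show ?thesis
        using False mtrace_mmult_adj[OF converse_in[OF s] aut_in[OF g s]] by simp
    qed
  qed simp
  then have trM: "mtrace \<Omega> M = ?n" using finite_classes Id_in by simp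
  have tr_prim: "mtrace \<Omega> (M \<bullet> R) = (if act S g R = R then ?n else 0)" if R: "R \<in> prim" for R
  proof -
    let ?m = "of_nat (mrank \<Omega> R) :: complex"
    note Rd = primD[OF R]
    have m: "?m \<noteq> 0" using mrank_pos[of R] Rd by simp
    \<comment> \<open>The eigenvalue at \<open>converse s\<close> is traded for the coefficient of
      \<open>R\<close> at \<open>s\<close>; summing over \<open>s\<close> then rebuilds
      \<open>act S g R\<close>.\<close>
    have MR: "(1 / ?v s) \<odot> (adj (converse s) \<bullet> adj (g s)) \<bullet> R
        = (?n / ?m * (coef R s * eigval R (adj (g s)))) \<odot> R" if s: "s \<in> S" for s
    proof -
      have "eigval R (adj (converse s)) = coef R s * (?n * ?v s) / ?m"
        using coef_prim[OF R s] m by (simp add: field_simps)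
      moreover have "adj (converse s) \<bullet> adj (g s) \<bullet> R
          = (eigval R (adj (g s)) * eigval R (adj (converse s))) \<odot> R"
        using prim_mmult[OF R alg_adj[OF aut_in[OF g s]]] prim_mmult[OF R alg_adj[OF converse_in[OF s]]]
        by (simp add: mmult_assoc)
      ultimately show ?thesis using v[OF s] m by (simp add: field_simps)
    qed
    have "M \<bullet> R = (\<Sum>s\<in>S. (?n / ?m * (coef R s * eigval R (adj (g s)))) \<odot> R)"
      unfolding M_def mmult_sum_left by (intro sum.cong refl) (simp only: mmult_smul_left MR)
    also have "\<dots> = (?n / ?m) \<odot> (\<Sum>s\<in>S. coef R s \<odot> (adj (g s) \<bullet> R))"
      unfolding smul_sum
      by (rule sum.cong) (simp_all add: prim_mmult[OF R alg_adj[OF aut_in[OF g]]])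
    also have "\<dots> = (?n / ?m) \<odot> (act S g R \<bullet> R)"
      by (simp add: act_def mmult_sum_left)
    finally have eq: "mtrace \<Omega> (M \<bullet> R) = ?n / ?m * mtrace \<Omega> (act S g R \<bullet> R)" by simp
    show ?thesis
    proof (cases "act S g R = R")
      case True
      then show ?thesis using eq Rd m mtrace_idem[of R] by simp
    next
      case False
      then show ?thesis using eq prim_orthogonal[OF act_prim[OF g h hg gh R] R] by simp
    qed
  qed
  \<comment> \<open>Each primitive contributes \<open>0\<close> or \<open>card \<Omega>\<close>, so
    sums of orthogonal primitives contribute natural numbers.\<close>
  have tr_idem: "\<exists>j :: nat. mtrace \<Omega> (M \<bullet> E) = of_nat j" if "idem E" for E
    using that
  proof (induction E rule: idem_induct)
    case zero
    show ?case by (intro exI[of _ 0]) (simp only: mmult_zero_right mtrace_zero of_nat_0)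
  next
    case (prim R)
    have "mtrace \<Omega> (M \<bullet> R) = of_nat (if act S g R = R then card \<Omega> else 0)"
      using tr_prim[OF prim] by simp
    then show ?case by blast
  next
    case (add E F)
    then obtain i j :: nat where "mtrace \<Omega> (M \<bullet> E) = of_nat i" "mtrace \<Omega> (M \<bullet> F) = of_nat j" by blast
    then have "mtrace \<Omega> (M \<bullet> (E + F)) = of_nat (i + j)"
      by (simp only: mmult_add_right mtrace_add of_nat_add)
    then show ?case by blast
  qed
  note Pd = primD[OF P]
  have ort: "P \<bullet> P0 \<Omega> = 0" "P0 \<Omega> \<bullet> P = 0"
    using prim_orthogonal[OF P P0_prim ne] prim_orthogonal[OF P0_prim P ne[symmetric]] by blast+
  let ?Q = "P0 \<Omega> + P"
  have Q: "idem ?Q"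
    using Pd ort by (simp add: alg_add P0_alg mmult_add_left mmult_add_right P0_idempotent)
  have "idem (unit - ?Q)"
    using idem_complement(1)[OF Q, of unit] Q unit_alg unit_mmult mmult_unit by blast
  then obtain j :: nat where j: "mtrace \<Omega> (M \<bullet> (unit - ?Q)) = of_nat j" using tr_idem by blast
  \<comment> \<open>The complement of \<open>P0 + P\<close> would contribute
    \<open>n - (n + n)\<close>, which is negative.\<close>
  have "mtrace \<Omega> (M \<bullet> (unit - ?Q)) = mtrace \<Omega> M - (mtrace \<Omega> (M \<bullet> P0 \<Omega>) + mtrace \<Omega> (M \<bullet> P))"
    unfolding mmult_diff_right mmult_add_right mtrace_diff mtrace_add mmult_unit[OF M] ..
  also have "\<dots> = - ?n"
    using tr_prim[OF P] tr_prim[OF P0_prim] fix_P act_P0[OF g] trM by simp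
  finally have "of_nat (j + card \<Omega>) = (0 :: complex)" using j by simp
  then have "card \<Omega> = 0" by (simp only: of_nat_eq_0_iff add_is_0)
  then show False using n by simp
qed

end

section \<open>Merging along a semiregular group\<close>

locale semiregular_group = comm_scheme +
  fixes G :: "('a rel \<Rightarrow> 'a rel) set"
  assumes group: "alg_iso_group S G"
    and semiregular: "semiregular_on G (S - {Id_on \<Omega>})"
begin

abbreviation S\<^sub>G :: "'a rel set" where "S\<^sub>G \<equiv> merged G S"

lemma group_aut: "g \<in> G \<Longrightarrow> algebraic_automorphism S g"
  and group_ext: "g \<in> G \<Longrightarrow> r \<notin> S \<Longrightarrow> g r = r"
  and group_id: "id \<in> G"
  and group_comp: "g \<in> G \<Longrightarrow> h \<in> G \<Longrightarrow> g \<circ> h \<in> G"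
  using group unfolding alg_iso_group_def by blast+

text \<open>Only left inverses are postulated; the left inverse \<open>k\<close> of \<open>h\<close>
  equals \<open>g\<close>, so \<open>h\<close> is two-sided.\<close>

lemma group_inverse:
  assumes "g \<in> G"
  obtains h where "h \<in> G" "h \<circ> g = id" "g \<circ> h = id"
proof -
  obtain h where h: "h \<in> G" "h \<circ> g = id"
    using group assms unfolding alg_iso_group_def by blast
  obtain k where k: "k \<in> G" "k \<circ> h = id"
    using group h(1) unfolding alg_iso_group_def by blast
  have "k = k \<circ> (h \<circ> g)" using h(2) by simp
  also have "\<dots> = g" using k(2) by (simp flip: comp_assoc)
  finally show ?thesis using that h k(2) by blast
qed

lemma group_in: "g \<in> G \<Longrightarrow> s \<in> S \<Longrightarrow> g s \<in> S"
  using aut_in group_aut by blast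

lemma group_eqI:
  assumes "g \<in> G" "h \<in> G" "s \<in> S" "s \<noteq> Id_on \<Omega>" "g s = h s"
  shows "g = h"
proof -
  obtain k where k: "k \<in> G" "k \<circ> h = id" "h \<circ> k = id" using group_inverse assms(2) by blast
  have "(k \<circ> g) s = s" using assms(5) fun_cong[OF k(2), of s] by simp
  then have "k \<circ> g = id"
    using semiregular group_comp[OF k(1) assms(1)] assms(3,4) unfolding semiregular_on_def by blast
  then have "h \<circ> (k \<circ> g) = h" by simp
  then show ?thesis using k(3) by (simp flip: comp_assoc)
qed

text \<open>Group elements are the identity outside the finite set \<open>S\<close>, so each is
  determined by its graph on \<open>S\<close>.\<close>

lemma finite_group: "finite G"
proof (rule finite_imageD)
  let ?f = "\<lambda>g. (\<lambda>s. (s, g s)) ` S"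
  have "?f ` G \<subseteq> Pow (S \<times> S)" using group_in by auto
  then show "finite (?f ` G)" using finite_classes by (meson finite_Pow_iff finite_SigmaI finite_subset)
  show "inj_on ?f G"
  proof (rule inj_onI, rule ext)
    fix g h r assume gh: "g \<in> G" "h \<in> G" "?f g = ?f h"
    show "g r = h r"
    proof (cases "r \<in> S")
      case True
      then have "(r, g r) \<in> ?f h" unfolding gh(3)[symmetric] by blast
      then show ?thesis by auto
    next
      case False
      then show ?thesis using group_ext[OF gh(1)] group_ext[OF gh(2)] by simp
    qed
  qed
qed

lemma bij_comp_group:
  assumes "h \<in> G"
  shows "bij_betw (\<lambda>g. h \<circ> g) G G"
proof -
  obtain k where k: "k \<in> G" "k \<circ> h = id" "h \<circ> k = id" using group_inverse assms by blast
  show ?thesis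
    by (rule bij_betw_byWitness[of _ "\<lambda>g. k \<circ> g"])
      (use k assms group_comp in \<open>auto simp flip: comp_assoc\<close>)
qed

lemma mem_orbit_iff:
  assumes "s \<in> S" "t \<in> S" "p \<in> t"
  shows "p \<in> orbit_rel G s \<longleftrightarrow> (\<exists>g\<in>G. t = g s)"
  using class_unique[OF assms(2) group_in[OF _ assms(1)] assms(3)] assms(3)
  unfolding orbit_rel_def by blast

lemma subset_orbit: "s \<subseteq> orbit_rel G s"
  unfolding orbit_rel_def using UN_upper[OF group_id, of "\<lambda>g. g s"] by simp

lemma orbit_image_subset:
  assumes "g \<in> G"
  shows "orbit_rel G (g s) \<subseteq> orbit_rel G s"
proof
  fix p assume "p \<in> orbit_rel G (g s)"
  then obtain h where "h \<in> G" "p \<in> (h \<circ> g) s" by (auto simp: orbit_rel_def)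
  then show "p \<in> orbit_rel G s" using group_comp[OF _ assms] unfolding orbit_rel_def by blast
qed

lemma orbit_image:
  assumes "g \<in> G"
  shows "orbit_rel G (g s) = orbit_rel G s"
proof
  obtain k where k: "k \<in> G" "k \<circ> g = id" using group_inverse assms by blast
  show "orbit_rel G s \<subseteq> orbit_rel G (g s)"
    using orbit_image_subset[OF k(1), of "g s"] fun_cong[OF k(2), of s] by simp
qed (rule orbit_image_subset[OF assms])

lemma orbit_Id: "orbit_rel G (Id_on \<Omega>) = Id_on \<Omega>"
proof -
  have "orbit_rel G (Id_on \<Omega>) = (\<Union>g\<in>G. Id_on \<Omega>)"
    unfolding orbit_rel_def by (intro SUP_cong refl aut_Id group_aut)
  then show ?thesis using group_id by auto
qed

lemma orbit_subset: "s \<in> S \<Longrightarrow> orbit_rel G s \<subseteq> \<Omega> \<times> \<Omega>"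
  unfolding orbit_rel_def using group_in class_subset by blast

lemma merged_partition: "partition_of (\<Omega> \<times> \<Omega>) S\<^sub>G"
  unfolding partition_of_def
proof (intro conjI ballI impI)
  show "s \<noteq> {}" if "s \<in> S\<^sub>G" for s
    using that class_nonempty subset_orbit unfolding merged_def by blast
  show "\<Union>S\<^sub>G = \<Omega> \<times> \<Omega>"
  proof
    show "\<Union>S\<^sub>G \<subseteq> \<Omega> \<times> \<Omega>" using orbit_subset by (auto simp: merged_def)
    show "\<Omega> \<times> \<Omega> \<subseteq> \<Union>S\<^sub>G"
    proof clarify
      fix x y assume "x \<in> \<Omega>" "y \<in> \<Omega>"
      then obtain s where "s \<in> S" "(x, y) \<in> s" using class_exists by blast
      then show "(x, y) \<in> \<Union>S\<^sub>G" unfolding merged_def using subset_orbit by blast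
    qed
  qed
  fix r s assume rs: "r \<in> S\<^sub>G" "s \<in> S\<^sub>G" "r \<noteq> s"
  then obtain r' s' where r': "r' \<in> S" "r = orbit_rel G r'" and s': "s' \<in> S" "s = orbit_rel G s'"
    by (auto simp: merged_def)
  show "r \<inter> s = {}"
  proof (rule ccontr)
    assume "r \<inter> s \<noteq> {}"
    then obtain p where p: "p \<in> r" "p \<in> s" by blast
    then obtain g where g: "g \<in> G" "p \<in> g r'" using r' by (auto simp: orbit_rel_def)
    then obtain h where "h \<in> G" "g r' = h s'"
      using p s' mem_orbit_iff[OF s'(1) group_in[OF g(1) r'(1)] g(2)] by blast
    then have "r = s" using r' s' g orbit_image by metis
    then show False using rs by blast
  qed
qed

lemmas mem_merged_alg_iff = mem_adj_algebra_iff[OF finite_points merged_partition]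

text \<open>Constancy on a merged relation means equal coefficients along a \<open>G\<close>-orbit.
  The fixed-point form makes closure under products immediate.\<close>

lemma merged_alg_iff:
  "X \<in> adj_algebra S\<^sub>G \<longleftrightarrow> X \<in> alg \<and> (\<forall>g\<in>G. act S g X = X)"
proof
  assume "X \<in> adj_algebra S\<^sub>G"
  then have supp: "\<And>x y. x \<notin> \<Omega> \<or> y \<notin> \<Omega> \<Longrightarrow> X x y = 0"
    and const: "\<And>s x y x' y'. s \<in> S \<Longrightarrow> (x, y) \<in> orbit_rel G s \<Longrightarrow> (x', y') \<in> orbit_rel G s \<Longrightarrow> X x y = X x' y'"
    unfolding mem_merged_alg_iff by (simp, metis merged_def imageI)
  have X: "X \<in> alg" by (rule algI) (use supp const subset_orbit in blast)+
  moreover have "act S g X = X" if g: "g \<in> G" for g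
  proof (rule act_eqI[OF group_aut[OF g] X])
    fix s assume s: "s \<in> S"
    obtain x y x' y' where xy: "(x, y) \<in> s" "(x', y') \<in> g s"
      using class_nonempty[OF s] class_nonempty[OF group_in[OF g s]] by fastforce
    then have "(x, y) \<in> orbit_rel G s" "(x', y') \<in> orbit_rel G s"
      using subset_orbit g by (auto simp: orbit_rel_def)
    then have "X x y = X x' y'" by (rule const[OF s])
    then show "coef X (g s) = coef X s"
      using coef_apply[OF X s xy(1)] coef_apply[OF X group_in[OF g s] xy(2)] by simp
  qed
  ultimately show "X \<in> alg \<and> (\<forall>g\<in>G. act S g X = X)" by blast
next
  assume "X \<in> alg \<and> (\<forall>g\<in>G. act S g X = X)"
  then have X: "X \<in> alg" and inv: "\<And>g. g \<in> G \<Longrightarrow> act S g X = X" by auto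
  have val: "X x y = coef X s" if s: "s \<in> S" and xy: "(x, y) \<in> orbit_rel G s" for x y s
  proof -
    obtain g where g: "g \<in> G" "(x, y) \<in> g s" using xy by (auto simp: orbit_rel_def)
    have "X x y = coef X (g s)" by (rule coef_apply[OF X group_in[OF g(1) s] g(2)])
    also have "\<dots> = coef X s" using coef_act[OF group_aut[OF g(1)] s, of X] inv[OF g(1)] by simp
    finally show ?thesis .
  qed
  show "X \<in> adj_algebra S\<^sub>G"
    unfolding mem_merged_alg_iff
  proof (intro conjI allI ballI impI)
    show "X x y = 0" if "x \<notin> \<Omega> \<or> y \<notin> \<Omega>" for x y using alg_support[OF X that] .
    fix s x y x' y' assume s: "s \<in> S\<^sub>G" and p: "(x, y) \<in> s" "(x', y') \<in> s"
    then obtain r where "r \<in> S" "s = orbit_rel G r" by (auto simp: merged_def)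
    then show "X x y = X x' y'" using val p by metis
  qed
qed

lemma merged_mmult:
  assumes "X \<in> adj_algebra S\<^sub>G" "Y \<in> adj_algebra S\<^sub>G"
  shows "X \<bullet> Y \<in> adj_algebra S\<^sub>G"
  using assms alg_mmult act_mmult[OF group_aut] unfolding merged_alg_iff by simp

text \<open>The product of two merged adjacency matrices is again fixed by \<open>G\<close>, hence
  constant on merged relations, and its entries are the path counts.\<close>

lemma merged_scheme: "scheme \<Omega> S\<^sub>G"
  unfolding scheme_def coherent_configuration_def
proof (intro conjI ballI allI impI)
  show Id: "Id_on \<Omega> \<in> S\<^sub>G" using orbit_Id Id_in by (force simp: merged_def)
  then show "\<exists>T\<subseteq>S\<^sub>G. \<Union>T = Id_on \<Omega>" by (intro exI[of _ "{Id_on \<Omega>}"]) simp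
  show "converse r \<in> S\<^sub>G" if r: "r \<in> S\<^sub>G" for r
  proof -
    obtain s where s: "s \<in> S" "r = orbit_rel G s" using r by (auto simp: merged_def)
    have "converse r = orbit_rel G (converse s)"
      using aut_converse[OF group_aut s(1)] by (auto simp: s(2) orbit_rel_def)
    then show ?thesis using s converse_in by (simp add: merged_def)
  qed
  fix r s t x z x' z'
  assume r: "r \<in> S\<^sub>G" and s: "s \<in> S\<^sub>G" and t: "t \<in> S\<^sub>G" "(x, z) \<in> t" "(x', z') \<in> t"
  have "adj r \<bullet> adj s \<in> adj_algebra S\<^sub>G"
    by (intro merged_mmult adj_mem_adj_algebra[OF finite_points merged_partition] r s)
  then have "(adj r \<bullet> adj s) x z = (adj r \<bullet> adj s) x' z'"
    using t unfolding mem_merged_alg_iff by blast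
  moreover have "r \<subseteq> \<Omega> \<times> \<Omega>" using r merged_partition by (auto simp: partition_of_def)
  ultimately show "card {y. (x, y) \<in> r \<and> (y, z) \<in> s} = card {y. (x', y) \<in> r \<and> (y, z') \<in> s}"
    by (simp add: mmult_adj[OF finite_points])
qed (fact finite_points merged_partition)+

lemma merged_commutative: "commutative_cc \<Omega> S\<^sub>G"
  using commutative merged_alg_iff unfolding commutative_cc_def by blast

text \<open>By semiregularity a nondiagonal merged relation is the disjoint union of
  \<open>card G\<close> relations \<open>g s\<close>, none of them the diagonal, each of valency
  \<open>k\<close>.\<close>

lemma merged_valency:
  assumes val: "\<And>s. s \<in> S \<Longrightarrow> s \<noteq> Id_on \<Omega> \<Longrightarrow> has_valency \<Omega> s k"
    and r: "r \<in> S\<^sub>G" "r \<noteq> Id_on \<Omega>"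
  shows "has_valency \<Omega> r (k * card G)"
  unfolding has_valency_def
proof
  fix x assume x: "x \<in> \<Omega>"
  obtain s where s: "s \<in> S" "r = orbit_rel G s" using r by (auto simp: merged_def)
  then have ne: "s \<noteq> Id_on \<Omega>" using r(2) orbit_Id by auto
  have g_ne: "g s \<noteq> Id_on \<Omega>" if "g \<in> G" for g
    using aut_Id[OF group_aut[OF that]] aut_inj[OF group_aut[OF that] s(1) Id_in] ne by metis
  have "{y. (x, y) \<in> r} = (\<Union>g\<in>G. {y. (x, y) \<in> g s})" by (auto simp: s(2) orbit_rel_def)
  also have "card \<dots> = (\<Sum>g\<in>G. card {y. (x, y) \<in> g s})"
  proof (rule card_UN_disjoint[OF finite_group])
    show "\<forall>g\<in>G. finite {y. (x, y) \<in> g s}"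
      using class_subset[OF group_in[OF _ s(1)]] finite_points
      by (auto intro: finite_subset[of _ \<Omega>])
    show "\<forall>g\<in>G. \<forall>h\<in>G. g \<noteq> h \<longrightarrow> {y. (x, y) \<in> g s} \<inter> {y. (x, y) \<in> h s} = {}"
    proof (intro ballI impI)
      fix g h assume gh: "g \<in> G" "h \<in> G" "g \<noteq> h"
      then have "g s \<noteq> h s" using group_eqI s(1) ne by blast
      then show "{y. (x, y) \<in> g s} \<inter> {y. (x, y) \<in> h s} = {}"
        using class_unique[OF group_in[OF gh(1) s(1)] group_in[OF gh(2) s(1)]] by blast
    qed
  qed
  also have "\<dots> = (\<Sum>g\<in>G. k)"
  proof (rule sum.cong)
    fix g assume g: "g \<in> G"
    show "card {y. (x, y) \<in> g s} = k"
      using val[OF group_in[OF g s(1)] g_ne[OF g]] x by (simp add: has_valency_def)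
  qed simp
  finally show "card {y. (x, y) \<in> r} = k * card G" by simp
qed

end

section \<open>Primitive idempotents of the merged scheme\<close>

sublocale semiregular_group \<subseteq> merged: comm_scheme \<Omega> "merged G S"
  by unfold_locales (fact merged_scheme merged_commutative)+

context semiregular_group
begin

text \<open>If the images agree, the inverse of \<open>h\<close> composed with \<open>g\<close>
  fixes \<open>P\<close>; a nonidentity element fixes only the diagonal relation, hence only the
  primitive \<open>P0\<close>.\<close>

lemma act_inj_on_group:
  assumes P: "P \<in> prim" "P \<noteq> P0 \<Omega>" and g: "g \<in> G" and h: "h \<in> G" and eq: "act S g P = act S h P"
  shows "g = h"
proof -
  note Pa = primD(1)[OF P(1)]
  obtain k where k: "k \<in> G" "k \<circ> h = id" "h \<circ> k = id" using group_inverse h by blast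
  have kg: "k \<circ> g \<in> G" using k(1) g by (rule group_comp)
  have "act S (k \<circ> g) P = act S k (act S g P)"
    by (rule act_act[symmetric]) (intro group_aut k g kg Pa)+
  also have "\<dots> = act S (k \<circ> h) P"
    unfolding eq by (rule act_act) (intro group_aut k h group_comp Pa)+
  also have "\<dots> = P" unfolding k(2) by (rule act_id[OF Pa])
  finally have fix_P: "act S (k \<circ> g) P = P" .
  obtain l where l: "l \<in> G" "l \<circ> (k \<circ> g) = id" "(k \<circ> g) \<circ> l = id" using group_inverse kg by blast
  have "k \<circ> g = id"
  proof (rule ccontr)
    assume "k \<circ> g \<noteq> id"
    then have "s = Id_on \<Omega>" if "s \<in> S" "(k \<circ> g) s = s" for s
      using semiregular kg that unfolding semiregular_on_def by blast
    then have "P = P0 \<Omega>"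
      using fixed_prim_eq_P0[OF group_aut[OF kg] group_aut[OF l(1)] l(2,3) _ P(1) fix_P] by blast
    then show False using P(2) by simp
  qed
  then have "h \<circ> (k \<circ> g) = h" by simp
  then show ?thesis using k(3) by (simp flip: comp_assoc)
qed

text \<open>The orbit sum of a primitive \<open>P\<close> below \<open>Q\<close> is a nonzero
  invariant idempotent, and it lies below \<open>Q\<close> because \<open>Q\<close> is invariant.
  Minimality of \<open>Q\<close> in the fixed algebra gives equality.\<close>

lemma merged_prim_orbit_sum:
  assumes Q: "Q \<in> merged.prim" "Q \<noteq> P0 \<Omega>"
  shows "\<exists>P\<in>prim. P \<noteq> P0 \<Omega> \<and> Q = (\<Sum>g\<in>G. act S g P)"
proof -
  note Qd = merged.primD[OF Q(1)]
  have Qa: "Q \<in> alg" and Q_inv: "\<And>g. g \<in> G \<Longrightarrow> act S g Q = Q"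
    using Qd(1) merged_alg_iff by auto
  obtain P where P: "P \<in> prim" "Q \<bullet> P = P"
    using idem_dominates_prim[of Q] Qa Qd by blast
  note Pd = primD[OF P(1)]
  \<comment> \<open>\<open>P0\<close> is primitive in the merged scheme too, so it is orthogonal to
    \<open>Q\<close> and cannot be the chosen \<open>P\<close>.\<close>
  have "Q \<bullet> P0 \<Omega> = 0" by (rule merged.prim_orthogonal[OF Q(1) merged.P0_prim Q(2)])
  then have ne: "P \<noteq> P0 \<Omega>" using P(2) Pd(3) by auto
  let ?R = "\<Sum>g\<in>G. act S g P"
  have Ra: "?R \<in> alg" by (intro alg_sum act_alg group_aut)
  have act_prim_G: "act S g P \<in> prim" if g: "g \<in> G" for g
  proof -
    obtain k where "k \<in> G" "k \<circ> g = id" "g \<circ> k = id" using group_inverse g by blast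
    then show ?thesis using act_prim[OF group_aut[OF g] group_aut] P(1) by blast
  qed
  have "act S h ?R = ?R" if h: "h \<in> G" for h
  proof -
    have "act S h ?R = (\<Sum>g\<in>G. act S (h \<circ> g) P)"
      unfolding act_sum by (intro sum.cong refl act_act group_aut h group_comp Pd(1))
    also have "\<dots> = ?R" by (rule sum.reindex_bij_betw[OF bij_comp_group[OF h]])
    finally show ?thesis .
  qed
  then have R_merged: "?R \<in> adj_algebra S\<^sub>G" using merged_alg_iff Ra by blast
  \<comment> \<open>Distinct group elements give distinct, hence orthogonal, primitives; only the
    term \<open>h = g\<close> survives.\<close>
  have "act S g P \<bullet> ?R = act S g P" if g: "g \<in> G" for g
  proof -
    have "act S g P \<bullet> ?R = (\<Sum>h\<in>G. if h = g then act S g P else 0)"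
      unfolding mmult_sum_right
    proof (rule sum.cong)
      fix h assume h: "h \<in> G"
      show "act S g P \<bullet> act S h P = (if h = g then act S g P else 0)"
      proof (cases "h = g")
        case True
        then show ?thesis using primD(2)[OF act_prim_G[OF g]] by simp
      next
        case False
        then have "act S g P \<noteq> act S h P" using act_inj_on_group[OF P(1) ne g h] by blast
        then show ?thesis using prim_orthogonal[OF act_prim_G[OF g] act_prim_G[OF h]] False by simp
      qed
    qed simp
    also have "\<dots> = act S g P" using g finite_group by (simp only: sum.delta if_True)
    finally show ?thesis .
  qed
  then have "?R \<bullet> ?R = ?R" unfolding mmult_sum_left by (intro sum.cong refl)
  moreover have "?R \<bullet> Q = ?R"
    unfolding mmult_sum_left
  proof (rule sum.cong)
    fix g assume g: "g \<in> G"
    have "act S g P \<bullet> Q = act S g P \<bullet> act S g Q" using Q_inv[OF g] by simp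
    also have "\<dots> = act S g (P \<bullet> Q)" by (rule act_mmult[OF group_aut[OF g] Pd(1) Qa, symmetric])
    also have "P \<bullet> Q = P" using P(2) mmult_commute[OF Pd(1) Qa] by simp
    finally show "act S g P \<bullet> Q = act S g P" .
  qed simp
  ultimately have "?R = 0 \<or> ?R = Q"
    using merged.prim_minimal[OF Q(1)] R_merged by blast
  moreover have "?R \<noteq> 0"
  proof
    assume "?R = 0"
    have "act S id P = act S id P \<bullet> ?R"
      using \<open>\<And>g. g \<in> G \<Longrightarrow> act S g P \<bullet> ?R = act S g P\<close>[OF group_id] by (rule sym)
    also have "\<dots> = 0" unfolding \<open>?R = 0\<close> by (rule mmult_zero_right)
    finally show False using primD(3)[OF act_prim_G[OF group_id]] by blast
  qed
  ultimately have "Q = ?R" by blast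
  with P(1) ne show ?thesis by blast
qed

lemma merged_mrank:
  assumes "Q \<in> merged.prim" "Q \<noteq> P0 \<Omega>"
  shows "\<exists>P\<in>prim. P \<noteq> P0 \<Omega> \<and> mrank \<Omega> Q = card G * mrank \<Omega> P"
proof -
  obtain P where P: "P \<in> prim" "P \<noteq> P0 \<Omega>" "Q = (\<Sum>g\<in>G. act S g P)"
    using merged_prim_orbit_sum[OF assms] by (elim bexE conjE)
  have "of_nat (mrank \<Omega> Q) = mtrace \<Omega> Q"
    using merged.mtrace_idem[of Q] merged.primD[OF assms(1)] by simp
  also have "\<dots> = (\<Sum>g\<in>G. mtrace \<Omega> P)"
    unfolding P(3) mtrace_sum by (intro sum.cong refl mtrace_act group_aut primD(1)[OF P(1)])
  also have "\<dots> = of_nat (card G * mrank \<Omega> P)"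
    using mtrace_idem[of P] primD[OF P(1)] by simp
  finally have "mrank \<Omega> Q = card G * mrank \<Omega> P" by (simp only: of_nat_eq_iff)
  with P show ?thesis by blast
qed

end

theorem theorem2p4:
  fixes \<Omega> :: "'a set" and S :: "'a rel set" and k :: nat
    and G :: "('a rel \<Rightarrow> 'a rel) set"
  assumes "scheme \<Omega> S"
    and "commutative_cc \<Omega> S"
    and "pseudocyclic_of_valency \<Omega> S k"
    and "alg_iso_group S G"
    and "semiregular_on G (S - {Id_on \<Omega>})"
  shows "scheme \<Omega> (merged G S) \<and> commutative_cc \<Omega> (merged G S) \<and>
         pseudocyclic_of_valency \<Omega> (merged G S) (k * card G)"
proof -
  interpret semiregular_group \<Omega> S G
    using assms by unfold_locales
  obtain q where q: "\<And>P. P \<in> prim \<Longrightarrow> P \<noteq> P0 \<Omega> \<Longrightarrow> m_P \<Omega> S P / real (n_P \<Omega> S P) = q"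
    using assms(3) unfolding pseudocyclic_of_valency_def pseudocyclic_def by blast
  \<comment> \<open>With \<open>n_P = 1\<close> in both schemes the ratio is just the rank, which is
    multiplied by \<open>card G\<close>.\<close>
  have "m_P \<Omega> (merged G S) Q / real (n_P \<Omega> (merged G S) Q) = real (card G) * q"
    if Q: "Q \<in> merged.prim" "Q \<noteq> P0 \<Omega>" for Q
  proof -
    obtain P where P: "P \<in> prim" "P \<noteq> P0 \<Omega>" "mrank \<Omega> Q = card G * mrank \<Omega> P"
      using merged_mrank[OF Q] by blast
    then show ?thesis
      using q[OF P(1,2)] n_P_eq_1[OF P(1)] merged.n_P_eq_1[OF Q(1)] by (simp add: m_P_def)
  qed
  then have "pseudocyclic \<Omega> (merged G S)"
    unfolding pseudocyclic_def using merged_scheme by blast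
  moreover have "has_valency \<Omega> r (k * card G)" if "r \<in> merged G S - {Id_on \<Omega>}" for r
    using merged_valency[of k r] that assms(3) by (simp add: pseudocyclic_of_valency_def)
  ultimately show ?thesis
    using merged_scheme merged_commutative by (simp add: pseudocyclic_of_valency_def)
qed

end
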